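(* Let $0<p<\infty$, $H\in(0,1]$ and $\eta\in\mathbb{R}$. Suppose $\Omega\neq\emptyset$ is a proper $\kappa$-plump open set in $\mathbb{R}^d$ and $\phi:(0,\infty)\to(0,\infty)$ is a function so that either condition (T), or condition (T'), or condition (F) holds: (T) $\eta+\overline{\mathrm{dim}}_A(\partial\Omega)-d<0$, $\Omega$ is unbounded, and $\phi\in\mathrm{WUSC}(\eta,0,H^{-1})$; (T') $\eta+\overline{\mathrm{dim}}_A(\partial\Omega)-d<0$, $\Omega$ is bounded, and $\phi\in\mathrm{WUSC}(\eta,0,H^{-1})$; (F) $\eta+\underline{\mathrm{dim}}_A(\partial\Omega)-d>0$, $\Omega$ is bounded or $\partial\Omega$ is unbounded, and $\phi\in\mathrm{WLSC}(\eta,0,H)$. Then there exist constants $c=c(d,p,\Omega,\phi)$ and $R$ such that the inequality $$\int_\Omega\frac{|u(x)|^p}{\phi(d_\Omega(x))}\,dx\le c\int_\Omega\int_{\Omega\cap B(x,R\,d_\Omega(x))}\frac{|u(x)-u(y)|^p}{\phi(d_\Omega(x))\,d_\Omega(x)^d}\,dy\,dx+c\,\xi\,\|u\|_{L^p(\Omega)}^p$$ holds for all measurable functions $u:\Omega\to\mathbb{R}$ for which the left hand side is finite, with $\xi=0$ in the cases (T) and (F) and $\xi=1$ in the case (T').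
   Context: $B(x,r)$ is the ball with center $x$ and radius $r$, and $\overline B(x,r)$ the closed ball; $d_\Omega(x)=\mathrm{dist}(x,\partial\Omega)=\inf_{y\in\partial\Omega}|x-y|$; $\|u\|_{L^p(\Omega)}^p=\int_\Omega|u(x)|^p\,dx$ (also when $0<p<1$). A proper open set is one different from $\mathbb{R}^d$. The upper Assouad dimension $\overline{\mathrm{dim}}_A(E)$ of $E\subset\mathbb{R}^d$ is the infimum of all $q\ge0$ for which there is a constant $C=C(q)\ge1$ such that for all $x\in E$ and $0<r<\rho<\mathrm{diam}\,E$ the set $B(x,\rho)\cap E$ can be covered by at most $C(\rho/r)^q$ balls of radius $r$ centered at points of $E$. The lower Assouad dimension $\underline{\mathrm{dim}}_A(E)$ is the supremum of all $t\ge0$ for which there is a constant $c_0=c_0(t)>0$ such that for all $x\in E$ and $0<r<\rho<\mathrm{diam}\,E$ at least $c_0(\rho/r)^t$ balls of radius $r$ centered at points of $E$ are needed to cover $B(x,\rho)\cap E$. A set $E\subset\mathbb{R}^d$ is $\kappa$-plump, with $\kappa\in(0,1)$, if for each $0<r<\mathrm{diam}(E)$ and each $x\in\overline E$ there is $z\in\overline B(x,r)$ such that $B(z,\kappa r)\subset E$. For $\eta\in\mathbb{R}$ and $H\in(0,1]$, a function $\phi:(0,\infty)\to(0,\infty)$ belongs to $\mathrm{WLSC}(\eta,0,H)$ if $\phi(st)\ge H t^\eta\phi(s)$ for all $s>0$ and every $t\ge1$; it belongs to $\mathrm{WUSC}(\eta,0,H^{-1})$ if $\phi(st)\ge H t^\eta\phi(s)$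 for all $s>0$ and every $t\in(0,1]$. *)

theory Defs
  imports "HOL-Analysis.Analysis"
begin

text \<open>The library's \<^const>\<open>diameter\<close> is real-valued and has no meaningful value on unbounded sets,
  for which the bound below has to be infinite.\<close>

definition ediam :: "'a::metric_space set \<Rightarrow> ennreal" where
  "ediam E = (SUP x\<in>E. SUP y\<in>E. ennreal (dist x y))"

definition covers_by_balls :: "'a::metric_space set \<Rightarrow> real \<Rightarrow> 'a set \<Rightarrow> 'a set \<Rightarrow> bool" where
  "covers_by_balls E r A F \<longleftrightarrow> finite F \<and> F \<subseteq> E \<and> A \<subseteq> (\<Union>z\<in>F. ball z r)"

text \<open>Both dimensions are extended reals: for a set with at most one point the condition in the
  lower dimension is vacuous, and the supremum is infinite.\<close>

definition upper_Assouad_dim :: "'a::metric_space set \<Rightarrow> ereal" where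
  "upper_Assouad_dim E = Inf {ereal q | q. 0 \<le> q \<and>
     (\<exists>C\<ge>1. \<forall>x\<in>E. \<forall>r \<rho>. 0 < r \<and> r < \<rho> \<and> ennreal \<rho> < ediam E \<longrightarrow>
        (\<exists>F. covers_by_balls E r (ball x \<rho> \<inter> E) F \<and> real (card F) \<le> C * (\<rho> / r) powr q))}"

definition lower_Assouad_dim :: "'a::metric_space set \<Rightarrow> ereal" where
  "lower_Assouad_dim E = Sup {ereal t | t. 0 \<le> t \<and>
     (\<exists>c0>0. \<forall>x\<in>E. \<forall>r \<rho>. 0 < r \<and> r < \<rho> \<and> ennreal \<rho> < ediam E \<longrightarrow>
        (\<forall>F. covers_by_balls E r (ball x \<rho> \<inter> E) F \<longrightarrow> c0 * (\<rho> / r) powr t \<le> real (card F)))}"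

definition plump :: "real \<Rightarrow> 'a::metric_space set \<Rightarrow> bool" where
  "plump \<kappa> E \<longleftrightarrow> 0 < \<kappa> \<and> \<kappa> < 1 \<and>
     (\<forall>r>0. ennreal r < ediam E \<longrightarrow> (\<forall>x\<in>closure E. \<exists>z\<in>cball x r. ball z (\<kappa> * r) \<subseteq> E))"

text \<open>The scaling classes with second parameter 0. Only the values on the positive half-line
  matter. The last parameter of the upper class is the reciprocal of the constant in the
  inequality.\<close>

definition WLSC0 :: "real \<Rightarrow> real \<Rightarrow> (real \<Rightarrow> real) set" where
  "WLSC0 \<eta> H = {\<phi>. (\<forall>s>0. 0 < \<phi> s) \<and>
     (\<forall>s>0. \<forall>t\<ge>1. \<phi> (s * t) \<ge> H * t powr \<eta> * \<phi> s)}"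

definition WUSC0 :: "real \<Rightarrow> real \<Rightarrow> (real \<Rightarrow> real) set" where
  "WUSC0 \<eta> K = {\<phi>. (\<forall>s>0. 0 < \<phi> s) \<and>
     (\<forall>s>0. \<forall>t. 0 < t \<and> t \<le> 1 \<longrightarrow> \<phi> (s * t) \<ge> inverse K * t powr \<eta> * \<phi> s)}"

definition bdist :: "'a::metric_space set \<Rightarrow> 'a \<Rightarrow> real" where
  "bdist \<Omega> x = infdist x (frontier \<Omega>)"

end

theory Submission
  imports Defs
begin

text \<open>Write \<open>\<delta>(x)\<close> for the distance of \<open>x\<close> to the boundary and \<open>d\<close> for the dimension of the space.
  The idea is to compare \<open>u x\<close> with its values on a set of points \<open>y\<close> in \<open>\<Omega>\<close> whose distance to \<open>x\<close>
  is less than \<open>R * \<delta>(x)\<close> and whose depth differs from that of \<open>x\<close> by a large factor \<open>M\<close>.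
  Averaging the inequality \<open>\<bar>u x\<bar> powr p \<le> 2 powr p * (\<bar>u x - u y\<bar> powr p + \<bar>u y\<bar> powr p)\<close> over this
  set and integrating against \<open>1 / \<phi>(\<delta>(x))\<close> produces the double integral on the right hand side and,
  after exchanging the integrals, an integral of \<open>\<bar>u y\<bar> powr p\<close> against some weight \<open>K(y)\<close>. If \<open>K(y)\<close>
  is at most a small multiple of \<open>1 / \<phi>(\<delta>(y))\<close>, this term is at most half of the left hand side, and
  it is absorbed because the left hand side is finite. This is \<open>averaging_inequality\<close>.

  How small \<open>K\<close> is depends on how fast the weight changes with the depth, which is measured by \<open>\<eta>\<close>, and
  on how much volume lies at small depth, which is measured by the dimension of the boundary. If the
  boundary is thin, the averages are taken over points that are \<open>M\<close> times deeper; then \<open>K\<close> has relative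
  size \<open>M powr (\<eta> + q - d)\<close> for an exponent \<open>q\<close> admissible in the upper dimension
  (\<open>kernel_away_from_boundary\<close>). If it is fat, the averages are taken over points that are
  \<open>M\<close> times shallower; then \<open>K\<close> has relative size \<open>M powr (d - t - \<eta>)\<close> for an
  exponent \<open>t\<close> admissible in the lower dimension (\<open>kernel_towards_boundary\<close>). In both cases the exponent of \<open>M\<close> can be
  made negative and \<open>M\<close> is taken large.

  The deepest points of a bounded \<open>\<Omega>\<close> have nothing \<open>M\<close> times deeper to be compared with, which accounts for the
  additional norm in the thin bounded case.\<close>

section \<open>Distance to the boundary and diameters\<close>

lemma ennreal_less_ediam_iff:
  "ennreal r < ediam E \<longleftrightarrow> (\<exists>x\<in>E. \<exists>y\<in>E. ennreal r < ennreal (dist x y))"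
  by (simp add: ediam_def less_SUP_iff)

lemma less_ediam_of_unbounded:
  assumes "\<not> bounded E"
  shows "ennreal r < ediam E"
proof -
  obtain x y where "x \<in> E" "y \<in> E" "max r 0 < dist x y"
    using assms unfolding bounded_two_points by (meson not_le)
  then show ?thesis
    unfolding ennreal_less_ediam_iff by (intro bexI[of _ x] bexI[of _ y]) (auto simp: ennreal_less_iff ennreal_lessI)
qed

lemma frontier_closed_nonempty:
  fixes \<Omega> :: "'a::euclidean_space set"
  assumes "\<Omega> \<noteq> {}" "\<Omega> \<noteq> UNIV"
  shows "closed (frontier \<Omega>)" "frontier \<Omega> \<noteq> {}"
  using assms frontier_eq_empty by auto

lemma bdist_attained:
  fixes \<Omega> :: "'a::euclidean_space set"
  assumes "\<Omega> \<noteq> {}" "\<Omega> \<noteq> UNIV"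
  obtains w where "w \<in> frontier \<Omega>" "bdist \<Omega> x = dist x w"
  using infdist_attains_inf[OF frontier_closed_nonempty[OF assms], of x] unfolding bdist_def by blast

lemma bdist_le: "w \<in> frontier \<Omega> \<Longrightarrow> bdist \<Omega> x \<le> dist x w"
  unfolding bdist_def by (rule infdist_le)

lemma bdist_Lipschitz: "bdist \<Omega> x \<le> bdist \<Omega> y + dist x y"
  unfolding bdist_def by (rule infdist_triangle)

lemma bdist_pos:
  fixes \<Omega> :: "'a::euclidean_space set"
  assumes "open \<Omega>" "\<Omega> \<noteq> UNIV" "x \<in> \<Omega>"
  shows "0 < bdist \<Omega> x"
proof -
  have "x \<notin> frontier \<Omega>" using assms by (simp add: frontier_def interior_open)
  moreover have "\<Omega> \<noteq> {}" using assms(3) by blast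
  ultimately show ?thesis
    unfolding bdist_def using frontier_closed_nonempty[of \<Omega>] assms(2)
    by (intro infdist_pos_not_in_closed) auto
qed

lemma continuous_bdist: "continuous_on S (bdist \<Omega>)"
  unfolding bdist_def by (intro continuous_intros)

lemma bdist_ge_of_ball_subset:
  fixes \<Omega> :: "'a::euclidean_space set"
  assumes "open \<Omega>" "\<Omega> \<noteq> {}" "\<Omega> \<noteq> UNIV" "ball z s \<subseteq> \<Omega>"
  shows "s - dist z y \<le> bdist \<Omega> y"
proof -
  obtain w where w: "w \<in> frontier \<Omega>" "bdist \<Omega> y = dist y w"
    using bdist_attained[OF assms(2,3)] .
  have "w \<notin> ball z s"
    using w(1) assms(1,4) by (auto simp: frontier_def interior_open)
  then show ?thesis
    using w(2) dist_triangle[of z w y] by simp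
qed

lemma ball_bdist_subset:
  fixes \<Omega> :: "'a::euclidean_space set"
  assumes "x \<in> \<Omega>"
  shows "ball x (bdist \<Omega> x) \<subseteq> \<Omega>"
proof (rule ccontr)
  assume *: "\<not> ?thesis"
  then have "x \<in> ball x (bdist \<Omega> x)"
    by (metis ball_eq_empty centre_in_ball empty_subsetI not_le)
  then obtain w where "w \<in> ball x (bdist \<Omega> x)" "w \<in> frontier \<Omega>"
    using connected_Int_frontier[of "ball x (bdist \<Omega> x)" \<Omega>] * assms by blast
  then show False using bdist_le[of w \<Omega> x] by simp
qed

text \<open>Leaving a bounded set along a line, once in each direction, meets the boundary at two points
  with \<open>x\<close> between them, so the boundary is at least twice as wide as \<open>x\<close> is deep.\<close>

lemma bdist_less_ediam_frontier:
  fixes \<Omega> :: "'a::euclidean_space set"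
  assumes "open \<Omega>" "\<Omega> \<noteq> UNIV" "x \<in> \<Omega>" "bounded \<Omega> \<or> \<not> bounded (frontier \<Omega>)"
  shows "ennreal (bdist \<Omega> x) < ediam (frontier \<Omega>)"
proof (cases "bounded (frontier \<Omega>)")
  case False
  then show ?thesis by (rule less_ediam_of_unbounded)
next
  case True
  with assms have bdd: "bounded \<Omega>" by blast
  obtain e :: 'a where e: "norm e = 1"
    using norm_Basis nonempty_Basis by blast
  have ray: "\<exists>t\<ge>0. x + t *\<^sub>R v \<in> frontier \<Omega>" if v: "norm v = 1" for v
  proof -
    define S where "S = (\<lambda>t. x + t *\<^sub>R v) ` {0..}"
    have "connected S"
      unfolding S_def by (intro connected_continuous_image continuous_intros) auto
    moreover have "x \<in> S"
      unfolding S_def by (rule image_eqI[of _ _ 0]) auto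
    moreover have "S - \<Omega> \<noteq> {}"
    proof
      assume "S - \<Omega> = {}"
      then have "S \<subseteq> \<Omega>" by auto
      then obtain B where B: "\<And>z. z \<in> S \<Longrightarrow> dist x z \<le> B"
        using bounded_subset[OF bdd] bounded_any_center[of S x] by blast
      have "x + (\<bar>B\<bar> + 1) *\<^sub>R v \<in> S" unfolding S_def by auto
      from B[OF this] show False by (simp add: dist_norm v)
    qed
    ultimately have "S \<inter> frontier \<Omega> \<noteq> {}"
      using connected_Int_frontier[of S \<Omega>] assms(3) by blast
    then show ?thesis unfolding S_def by auto
  qed
  obtain t1 where t1: "t1 \<ge> 0" "x + t1 *\<^sub>R e \<in> frontier \<Omega>" using ray[OF e] by blast
  obtain t2 where t2: "t2 \<ge> 0" "x + t2 *\<^sub>R (- e) \<in> frontier \<Omega>" using ray[of "- e"] e by auto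
  have "bdist \<Omega> x \<le> t1" "bdist \<Omega> x \<le> t2"
    using bdist_le[OF t1(2), of x] bdist_le[OF t2(2), of x] t1 t2 by (simp_all add: dist_norm e)
  moreover have "dist (x + t1 *\<^sub>R e) (x + t2 *\<^sub>R (- e)) = t1 + t2"
  proof -
    have "x + t1 *\<^sub>R e - (x + t2 *\<^sub>R (- e)) = (t1 + t2) *\<^sub>R e" by (simp add: algebra_simps)
    then show ?thesis using t1 t2 e by (simp add: dist_norm)
  qed
  moreover have "0 < bdist \<Omega> x" using bdist_pos assms by blast
  ultimately have "ennreal (bdist \<Omega> x) < ennreal (dist (x + t1 *\<^sub>R e) (x + t2 *\<^sub>R (- e)))"
    by (intro ennreal_lessI) auto
  then show ?thesis unfolding ennreal_less_ediam_iff using t1 t2 by blast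
qed

lemma less_ediam_of_less_bdist:
  fixes \<Omega> :: "'a::euclidean_space set"
  assumes "x \<in> \<Omega>" "0 \<le> s" "s < bdist \<Omega> x"
  shows "ennreal s < ediam \<Omega>"
proof -
  obtain e :: 'a where e: "norm e = 1"
    using norm_Basis nonempty_Basis by blast
  define t where "t = (s + bdist \<Omega> x) / 2"
  have t: "s < t" "t < bdist \<Omega> x" using assms by (auto simp: t_def)
  have d: "dist x (x + t *\<^sub>R e) = t" using t assms by (simp add: dist_norm e)
  then have "x + t *\<^sub>R e \<in> \<Omega>" using ball_bdist_subset[OF assms(1)] t by auto
  moreover have "ennreal s < ennreal t" using t assms by (intro ennreal_lessI) auto
  ultimately show ?thesis unfolding ennreal_less_ediam_iff using assms(1) d by metis
qed

section \<open>Coverings and separated nets\<close>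

text \<open>Averaging near a deep point of a bounded set compares the boundary with balls larger than the
  boundary itself, whereas the dimension only speaks about radii below the diameter. A bounded set
  is covered by finitely many balls of one fixed small radius \<open>d0\<close>; larger balls then cost only
  this finite factor, and a set of diameter zero is covered by one ball.\<close>

lemma upper_Assouad_cover_all_scales:
  fixes E :: "'a::euclidean_space set"
  assumes "upper_Assouad_dim E < ereal b"
  obtains C q where "0 < C" "0 \<le> q" "q < b"
    "\<And>x r \<rho>. x \<in> E \<Longrightarrow> 0 < r \<Longrightarrow> r < \<rho> \<Longrightarrow>
       \<exists>F. covers_by_balls E r (ball x \<rho> \<inter> E) F \<and> real (card F) \<le> C * (\<rho> / r) powr q"
proof -
  obtain q C where q: "0 \<le> q" "q < b" and C: "1 \<le> C"
    and cov: "\<And>x r \<rho>. x \<in> E \<Longrightarrow> 0 < r \<Longrightarrow> r < \<rho> \<Longrightarrow> ennreal \<rho> < ediam E \<Longrightarrow>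
        \<exists>F. covers_by_balls E r (ball x \<rho> \<inter> E) F \<and> real (card F) \<le> C * (\<rho> / r) powr q"
    using assms unfolding upper_Assouad_dim_def Inf_less_iff by auto
  show thesis
  proof (cases "bounded E")
    case False
    then show thesis using that[of C q] C q cov less_ediam_of_unbounded[OF False] by simp
  next
    case True
    show thesis
    proof (cases "\<exists>d0>0. ennreal d0 < ediam E")
      case False
      have single: "y = x" if "x \<in> E" "y \<in> E" for x y
      proof (rule ccontr)
        assume "y \<noteq> x"
        then have "ennreal (dist x y / 2) < ennreal (dist x y)" by (intro ennreal_lessI) auto
        then have "ennreal (dist x y / 2) < ediam E" unfolding ennreal_less_ediam_iff using that by blast
        moreover have "0 < dist x y / 2" using \<open>y \<noteq> x\<close> by simp
        ultimately show False using False by blast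
      qed
      show thesis
      proof (rule that[of C q])
        fix r \<rho> :: real and x' assume "x' \<in> E" "0 < r" "r < \<rho>"
        have "E = {x'}" using single \<open>x' \<in> E\<close> by blast
        then have "covers_by_balls E r (ball x' \<rho> \<inter> E) {x'}"
          using \<open>0 < r\<close> by (auto simp: covers_by_balls_def)
        moreover have "1 \<le> C * (\<rho> / r) powr q"
          using C q \<open>0 < r\<close> \<open>r < \<rho>\<close> ge_one_powr_ge_zero[of "\<rho>/r" q] mult_mono[of 1 C 1 "(\<rho> / r) powr q"] by simp
        ultimately show "\<exists>F. covers_by_balls E r (ball x' \<rho> \<inter> E) F \<and> real (card F) \<le> C * (\<rho> / r) powr q"
          by (intro exI[of _ "{x'}"]) simp
      qed (use C q in auto)
    next
      case True
      then obtain d0 where d0: "d0 > 0" "ennreal d0 < ediam E" by blast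
      obtain K where K: "finite K" "K \<subseteq> E" "E \<subseteq> (\<Union>x\<in>K. ball x d0)"
      proof -
        have "compact (closure E)" using \<open>bounded E\<close> by simp
        moreover have "closure E \<subseteq> (\<Union>x\<in>E. ball x d0)"
        proof
          fix y assume "y \<in> closure E"
          then obtain x where "x \<in> E" "dist x y < d0" using d0(1) closure_approachable[of y E] by blast
          then show "y \<in> (\<Union>x\<in>E. ball x d0)" by auto
        qed
        ultimately obtain K where "K \<subseteq> E" "finite K" "closure E \<subseteq> (\<Union>x\<in>K. ball x d0)"
          using compactE_image[of "closure E" E "\<lambda>x. ball x d0"] by auto
        then show thesis using that closure_subset[of E] by blast
      qed
      show thesis
      proof (rule that[of "(real (card K) + 1) * C" q])
        fix r \<rho> :: real and x assume x: "x \<in> E" and r: "0 < r" "r < \<rho>"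
        have one: "1 \<le> (\<rho> / r) powr q"
          using q r ge_one_powr_ge_zero[of "\<rho>/r" q] by simp
        have KC: "real (card K) \<le> (real (card K) + 1) * C"
          using C mult_mono[of "real (card K)" "real (card K) + 1" 1 C] by simp
        consider "\<rho> \<le> d0" | "d0 < \<rho>" "r < d0" | "d0 \<le> r" by linarith
        then show "\<exists>F. covers_by_balls E r (ball x \<rho> \<inter> E) F
            \<and> real (card F) \<le> (real (card K) + 1) * C * (\<rho> / r) powr q"
        proof cases
          case 1
          then have "ennreal \<rho> < ediam E" using d0(2) ennreal_leI le_less_trans by blast
          then obtain F where F: "covers_by_balls E r (ball x \<rho> \<inter> E) F" "real (card F) \<le> C * (\<rho> / r) powr q"
            using cov[OF x r] by blast
          have "C * (\<rho> / r) powr q \<le> (real (card K) + 1) * C * (\<rho> / r) powr q"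
            using C by (intro mult_right_mono) auto
          then show ?thesis using F by force
        next
          case 2
          have "\<forall>z\<in>K. \<exists>F. covers_by_balls E r (ball z d0 \<inter> E) F \<and> real (card F) \<le> C * (d0 / r) powr q"
            using cov[of _ r d0] 2 r d0 K by blast
          then obtain F where F: "\<And>z. z \<in> K \<Longrightarrow> covers_by_balls E r (ball z d0 \<inter> E) (F z)"
            "\<And>z. z \<in> K \<Longrightarrow> real (card (F z)) \<le> C * (d0 / r) powr q" by metis
          have "covers_by_balls E r (ball x \<rho> \<inter> E) (\<Union>z\<in>K. F z)"
            unfolding covers_by_balls_def
          proof (intro conjI)
            show "finite (\<Union> (F ` K))" using K F(1) by (auto simp: covers_by_balls_def)
            show "\<Union> (F ` K) \<subseteq> E" using F(1) by (auto simp: covers_by_balls_def)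
            show "ball x \<rho> \<inter> E \<subseteq> (\<Union>z\<in>\<Union> (F ` K). ball z r)"
            proof
              fix y assume y: "y \<in> ball x \<rho> \<inter> E"
              then obtain z where z: "z \<in> K" "y \<in> ball z d0" using K by blast
              then show "y \<in> (\<Union>z\<in>\<Union> (F ` K). ball z r)"
                using F(1)[OF z(1)] y unfolding covers_by_balls_def by blast
            qed
          qed
          moreover have "real (card (\<Union>z\<in>K. F z)) \<le> (real (card K) + 1) * C * (\<rho> / r) powr q"
          proof -
            have "real (card (\<Union>z\<in>K. F z)) \<le> (\<Sum>z\<in>K. real (card (F z)))"
              using card_UN_le[OF K(1), of F] by (metis of_nat_le_iff of_nat_sum)
            also have "\<dots> \<le> (\<Sum>z\<in>K. C * (\<rho> / r) powr q)"
            proof (rule sum_mono)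
              fix z assume "z \<in> K"
              have "(d0 / r) powr q \<le> (\<rho> / r) powr q"
                using 2 r d0 q by (intro powr_mono2 divide_right_mono) auto
              then show "real (card (F z)) \<le> C * (\<rho> / r) powr q"
                using F(2)[OF \<open>z \<in> K\<close>] C by (smt (verit) mult_left_mono)
            qed
            also have "\<dots> = real (card K) * C * (\<rho> / r) powr q" by simp
            also have "\<dots> \<le> (real (card K) + 1) * C * (\<rho> / r) powr q"
              using C by (intro mult_right_mono) auto
            finally show ?thesis .
          qed
          ultimately show ?thesis by blast
        next
          case 3
          have "ball z d0 \<subseteq> ball z r" for z :: 'a using 3 by auto
          then have "E \<subseteq> (\<Union>z\<in>K. ball z r)" using K by blast
          then have "covers_by_balls E r (ball x \<rho> \<inter> E) K" using K by (auto simp: covers_by_balls_def)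
          moreover have "real (card K) \<le> (real (card K) + 1) * C * (\<rho> / r) powr q"
            using KC one mult_mono[OF KC one] C by simp
          ultimately show ?thesis by blast
        qed
      qed (use C q in auto)
    qed
  qed
qed

text \<open>The lower dimension bounds covers from below, but disjoint balls need separated centres. A
  separated set of largest cardinality supplies both, because maximality makes it a cover.\<close>

lemma exists_separated_net:
  fixes S :: "'a::euclidean_space set"
  assumes "bounded S" "0 < s"
  obtains P where "finite P" "P \<subseteq> S" "\<And>v w. v \<in> P \<Longrightarrow> w \<in> P \<Longrightarrow> v \<noteq> w \<Longrightarrow> s \<le> dist v w"
    "S \<subseteq> (\<Union>v\<in>P. ball v s)"
proof -
  define sep where "sep = (\<lambda>P. finite P \<and> P \<subseteq> S \<and> (\<forall>v\<in>P. \<forall>w\<in>P. v \<noteq> w \<longrightarrow> s \<le> dist v w))"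
  \<comment> \<open>Each ball of radius \<open>s / 2\<close> in a finite cover contains at most one point of a separated set,
    which bounds the cardinalities.\<close>
  obtain K where K: "finite K" "closure S \<subseteq> (\<Union>x\<in>K. ball x (s/2))"
    using seq_compact_imp_totally_bounded[of "closure S"] assms
    by (metis compact_closure compact_eq_seq_compact_metric half_gt_zero)
  have le: "card P \<le> card K" if "sep P" for P
  proof -
    have "\<forall>v\<in>P. \<exists>x\<in>K. v \<in> ball x (s/2)"
      using that K closure_subset[of S] unfolding sep_def by blast
    then obtain f where f: "\<And>v. v \<in> P \<Longrightarrow> f v \<in> K \<and> v \<in> ball (f v) (s/2)" by metis
    have "inj_on f P"
    proof (rule inj_onI)
      fix v w assume vw: "v \<in> P" "w \<in> P" "f v = f w"
      then have "dist (f v) v < s/2" "dist (f v) w < s/2" using f by (force, force)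
      then have "dist v w < s" using dist_triangle3[of v w "f v"] by simp
      then show "v = w" using that vw unfolding sep_def by force
    qed
    then show ?thesis using f K(1) by (intro card_inj_on_le[of f]) auto
  qed
  have "sep {}" by (simp add: sep_def)
  then obtain P where P: "sep P" "\<And>Q. sep Q \<Longrightarrow> card Q \<le> card P"
    using ex_has_greatest_nat[of sep "{}" card "Suc (card K)"] le by (auto simp: less_Suc_eq_le)
  have "S \<subseteq> (\<Union>v\<in>P. ball v s)"
  proof
    fix x assume x: "x \<in> S"
    show "x \<in> (\<Union>v\<in>P. ball v s)"
    proof (rule ccontr)
      assume "x \<notin> (\<Union>v\<in>P. ball v s)"
      then have far: "s \<le> dist v x" if "v \<in> P" for v using that by (auto simp: not_less)
      then have "x \<notin> P" using assms(2) by force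
      moreover have "sep (insert x P)"
        using P(1) x far unfolding sep_def by (auto simp: dist_commute)
      ultimately show False using P(2)[of "insert x P"] P(1) by (simp add: sep_def)
    qed
  qed
  then show thesis using that[of P] P(1) unfolding sep_def by blast
qed

section \<open>Volumes of unions of balls\<close>

lemma emeasure_lebesgue_ball:
  fixes z :: "'a::euclidean_space"
  assumes "0 \<le> r"
  shows "emeasure lebesgue (ball z r) = ennreal (unit_ball_vol (real DIM('a)) * r ^ DIM('a))"
  using emeasure_ball[OF assms, of z] by simp

lemma emeasure_le_of_cover_by_balls:
  fixes X :: "'a::euclidean_space set"
  assumes "finite F" "X \<subseteq> (\<Union>z\<in>F. ball z r)" "0 \<le> r"
  shows "emeasure lebesgue X \<le> ennreal (real (card F) * (unit_ball_vol (real DIM('a)) * r ^ DIM('a)))"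
proof -
  have "emeasure lebesgue X \<le> emeasure lebesgue (\<Union>z\<in>F. ball z r)"
    using assms by (intro emeasure_mono) auto
  also have "\<dots> \<le> (\<Sum>z\<in>F. emeasure lebesgue (ball z r))"
    using assms(1) by (intro emeasure_subadditive_finite) auto
  also have "\<dots> = ennreal (real (card F) * (unit_ball_vol (real DIM('a)) * r ^ DIM('a)))"
    using assms(3) by (simp add: emeasure_ball ennreal_of_nat_eq_real_of_nat ennreal_mult)
  finally show ?thesis .
qed

lemma emeasure_ge_of_disjoint_balls:
  fixes X :: "'a::euclidean_space set"
  assumes "finite P" "disjoint_family_on (\<lambda>v. ball (c v) r) P" "(\<Union>v\<in>P. ball (c v) r) \<subseteq> X"
    "X \<in> sets lebesgue" "0 \<le> r"
  shows "ennreal (real (card P) * (unit_ball_vol (real DIM('a)) * r ^ DIM('a))) \<le> emeasure lebesgue X"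
proof -
  have "ennreal (real (card P) * (unit_ball_vol (real DIM('a)) * r ^ DIM('a)))
      = (\<Sum>v\<in>P. emeasure lebesgue (ball (c v) r))"
    using assms(5) by (simp add: emeasure_ball ennreal_of_nat_eq_real_of_nat ennreal_mult)
  also have "\<dots> = emeasure lebesgue (\<Union>v\<in>P. ball (c v) r)"
    using assms by (intro sum_emeasure) auto
  also have "\<dots> \<le> emeasure lebesgue X" using assms by (intro emeasure_mono) auto
  finally show ?thesis .
qed

section \<open>Kernels that move mass between depths\<close>

text \<open>\<open>A\<close> pairs each point \<open>x\<close> with the points \<open>y\<close> over which \<open>u\<close> will be averaged, with density
  \<open>a / bdist \<Omega> x ^ d\<close>. On \<open>G\<close> the total mass of the average is at least one. Read backwards, the
  last clause is a pointwise bound times a volume bound; together they say that the points \<open>x\<close>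
  whose averages use a given \<open>y\<close> send to \<open>y\<close> at most \<open>\<epsilon>\<close> times its own weight \<open>1 / \<phi> (bdist \<Omega> y)\<close>.\<close>

definition averaging_kernel ::
    "'a::euclidean_space set \<Rightarrow> (real \<Rightarrow> real) \<Rightarrow> 'a set \<Rightarrow> real \<Rightarrow> real \<Rightarrow> real \<Rightarrow> ('a \<times> 'a) set \<Rightarrow> bool" where
  "averaging_kernel \<Omega> \<phi> G \<epsilon> a R A \<longleftrightarrow>
     open A \<and> 0 < a \<and> 0 < R \<and> (\<forall>(x, y)\<in>A. x \<in> \<Omega> \<and> y \<in> \<Omega> \<and> dist x y < R * bdist \<Omega> x) \<and>
     (\<forall>x\<in>G. ennreal (bdist \<Omega> x ^ DIM('a)) \<le> ennreal a * emeasure lebesgue {y. (x, y) \<in> A}) \<and>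
     (\<forall>y\<in>\<Omega>. \<exists>V\<ge>0. \<exists>B\<ge>0. B * V \<le> \<epsilon> \<and> emeasure lebesgue {x. (x, y) \<in> A} \<le> ennreal V \<and>
        (\<forall>x. (x, y) \<in> A \<longrightarrow> a / (bdist \<Omega> x ^ DIM('a) * \<phi> (bdist \<Omega> x)) \<le> B / \<phi> (bdist \<Omega> y)))"

lemma exists_large_powr_le:
  assumes "0 < \<gamma>" "0 < K" "0 < \<epsilon>"
  obtains M :: real where "m \<le> M" "1 < M" "K * M powr (- \<gamma>) \<le> \<epsilon>"
proof -
  define M where "M = max (max m 2) ((K / \<epsilon>) powr (1 / \<gamma>))"
  have M: "m \<le> M" "1 < M" "(K / \<epsilon>) powr (1 / \<gamma>) \<le> M" by (auto simp: M_def)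
  have "K / \<epsilon> = ((K / \<epsilon>) powr (1 / \<gamma>)) powr \<gamma>" using assms by (simp add: powr_powr)
  also have "\<dots> \<le> M powr \<gamma>" using M assms by (intro powr_mono2) auto
  finally have "K * M powr (- \<gamma>) \<le> \<epsilon>"
    using assms M by (simp add: powr_minus field_simps)
  then show thesis using that M by blast
qed

lemma powr_ge_of_ratio_bounds:
  fixes C z \<eta> :: real
  assumes "1 \<le> C" "1 / C \<le> z" "z \<le> C"
  shows "C powr (- \<bar>\<eta>\<bar>) \<le> z powr \<eta>"
proof -
  have "0 < 1 / C" using assms by simp
  then have z: "0 < z" using assms by linarith
  have "ln (1 / C) \<le> ln z" "ln z \<le> ln C" using assms z by (auto intro!: ln_mono simp del: ln_div)
  then have "\<bar>ln z\<bar> \<le> ln C" using assms by (simp add: ln_div)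
  then have "\<bar>\<eta>\<bar> * \<bar>ln z\<bar> \<le> \<bar>\<eta>\<bar> * ln C" by (intro mult_left_mono) auto
  moreover have "- (\<bar>\<eta>\<bar> * \<bar>ln z\<bar>) \<le> \<eta> * ln z" by (metis abs_ge_minus_self abs_mult minus_le_iff)
  ultimately have "- \<bar>\<eta>\<bar> * ln C \<le> \<eta> * ln z" by simp
  then show ?thesis using z assms by (simp add: powr_def)
qed

lemma open_pairs:
  fixes \<Omega> :: "'a::euclidean_space set"
  assumes "open \<Omega>"
  shows "open {(x, y). x \<in> \<Omega> \<and> y \<in> \<Omega> \<and> dist x y < R * bdist \<Omega> x \<and> l * bdist \<Omega> x < bdist \<Omega> y}"
    and "open {(x, y). x \<in> \<Omega> \<and> y \<in> \<Omega> \<and> dist x y < R * bdist \<Omega> x \<and> l * bdist \<Omega> x < bdist \<Omega> y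
      \<and> bdist \<Omega> y < u * bdist \<Omega> x}"
proof -
  have [intro]: "open {p :: 'a \<times> 'a. fst p \<in> \<Omega>}" "open {p :: 'a \<times> 'a. snd p \<in> \<Omega>}"
    using open_vimage_fst[OF assms] open_vimage_snd[OF assms] by (simp_all add: vimage_def)
  show "open {(x, y). x \<in> \<Omega> \<and> y \<in> \<Omega> \<and> dist x y < R * bdist \<Omega> x \<and> l * bdist \<Omega> x < bdist \<Omega> y}"
    "open {(x, y). x \<in> \<Omega> \<and> y \<in> \<Omega> \<and> dist x y < R * bdist \<Omega> x \<and> l * bdist \<Omega> x < bdist \<Omega> y
      \<and> bdist \<Omega> y < u * bdist \<Omega> x}"
    unfolding case_prod_unfold bdist_def
    by (intro open_Collect_conj open_Collect_less continuous_intros; blast)+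
qed

lemma WUSC0_D:
  assumes "\<phi> \<in> WUSC0 \<eta> (inverse H)"
  shows "0 < s \<Longrightarrow> 0 < \<phi> s"
    and "0 < s \<Longrightarrow> s \<le> t \<Longrightarrow> H * (s / t) powr \<eta> * \<phi> t \<le> \<phi> s"
proof -
  show "0 < s \<Longrightarrow> 0 < \<phi> s" using assms by (simp add: WUSC0_def)
  assume st: "0 < s" "s \<le> t"
  then have "inverse (inverse H) * (s / t) powr \<eta> * \<phi> t \<le> \<phi> (t * (s / t))"
    using assms unfolding WUSC0_def mem_Collect_eq by (metis divide_le_eq_1_pos divide_pos_pos less_le_trans)
  then show "H * (s / t) powr \<eta> * \<phi> t \<le> \<phi> s" using st by (simp del: times_divide_eq_left)
qed

lemma WLSC0_D:
  assumes "\<phi> \<in> WLSC0 \<eta> H"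
  shows "0 < s \<Longrightarrow> 0 < \<phi> s"
    and "0 < t \<Longrightarrow> t \<le> s \<Longrightarrow> H * (s / t) powr \<eta> * \<phi> t \<le> \<phi> s"
proof -
  show "0 < s \<Longrightarrow> 0 < \<phi> s" using assms by (simp add: WLSC0_def)
  assume st: "0 < t" "t \<le> s"
  then have "H * (s / t) powr \<eta> * \<phi> t \<le> \<phi> (t * (s / t))"
    using assms unfolding WLSC0_def mem_Collect_eq by (metis le_divide_eq_1_pos)
  then show "H * (s / t) powr \<eta> * \<phi> t \<le> \<phi> s" using st by (simp del: times_divide_eq_left)
qed

text \<open>Average over points that are about \<open>M\<close> times deeper. Plumpness at scale \<open>L \<delta>(x)\<close> with
  \<open>L = 2 M / \<kappa>\<close> provides a ball of radius comparable to \<open>M \<delta>(x)\<close> of such points, so \<open>a\<close> is of order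
  \<open>M powr (- d)\<close>. Conversely, the points \<open>x\<close> that use a given \<open>y\<close> have depth comparable to \<open>\<delta>(y) / M\<close> and lie at
  distance at most a constant times \<open>\<delta>(y)\<close> from \<open>y\<close>, hence within a thin layer along the boundary.
  For an admissible covering exponent \<open>q\<close>, covering the boundary at scale \<open>\<delta>(y) / M\<close> gives this layer volume at most a constant times
  \<open>M powr (q - d) * \<delta>(y) ^ d\<close>, while scaling makes the weight at \<open>x\<close> at most \<open>M powr \<eta>\<close> times that at
  \<open>y\<close>, up to a constant. So the mass sent to \<open>y\<close> has relative size \<open>M powr (\<eta> + q - d)\<close>, which is
  small for large \<open>M\<close>, because \<open>q\<close> can be taken below \<open>d - \<eta>\<close>.\<close>

lemma kernel_away_from_boundary:
  fixes \<Omega> :: "'a::euclidean_space set"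
  assumes \<Omega>: "open \<Omega>" "\<Omega> \<noteq> {}" "\<Omega> \<noteq> UNIV" and plump: "plump \<kappa> \<Omega>"
    and H: "0 < H" and \<phi>: "\<phi> \<in> WUSC0 \<eta> (inverse H)"
    and dim: "upper_Assouad_dim (frontier \<Omega>) < ereal (real DIM('a) - \<eta>)"
    and \<epsilon>: "0 < \<epsilon>"
  obtains L a R A where "0 < L"
    "averaging_kernel \<Omega> \<phi> {x \<in> \<Omega>. ennreal (L * bdist \<Omega> x) < ediam \<Omega>} \<epsilon> a R A"
proof -
  let ?n = "DIM('a)" and ?\<delta> = "bdist \<Omega>"
  define \<omega> where "\<omega> = unit_ball_vol (real ?n)"
  have \<omega>: "0 < \<omega>" by (simp add: \<omega>_def)
  have \<kappa>: "0 < \<kappa>" "\<kappa> < 1"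
    and pl: "\<And>r x. 0 < r \<Longrightarrow> ennreal r < ediam \<Omega> \<Longrightarrow> x \<in> \<Omega> \<Longrightarrow> \<exists>z\<in>cball x r. ball z (\<kappa> * r) \<subseteq> \<Omega>"
    using plump closure_subset[of \<Omega>] unfolding plump_def by auto
  obtain C q where C: "0 < C" and q: "0 \<le> q" "q < real ?n - \<eta>"
    and cov: "\<And>x r \<rho>. x \<in> frontier \<Omega> \<Longrightarrow> 0 < r \<Longrightarrow> r < \<rho> \<Longrightarrow>
       \<exists>F. covers_by_balls (frontier \<Omega>) r (ball x \<rho> \<inter> frontier \<Omega>) F \<and> real (card F) \<le> C * (\<rho> / r) powr q"
    using upper_Assouad_cover_all_scales[OF dim] by metis
  \<comment> \<open>All of the points \<open>y\<close> used lie within \<open>M * c * \<delta>(x)\<close> of \<open>x\<close>, and \<open>M\<close> cancels when this is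
    measured in units of \<open>\<delta>(y)\<close>: the region that uses \<open>y\<close> has a size independent of \<open>M\<close>.\<close>
  define c where "c = 1 + 2 / \<kappa>"
  have c: "1 \<le> c" using \<kappa> by (simp add: c_def)
  define K where "K = C * (c + 2) powr q * 2 ^ ?n * (2 * c) ^ ?n * (2 * c) powr \<bar>\<eta>\<bar> / H"
  have K: "0 < K" unfolding K_def using C c H by simp
  obtain M where M: "1 < M" "K * M powr (- (real ?n - \<eta> - q)) \<le> \<epsilon>"
    using exists_large_powr_le[of "real ?n - \<eta> - q" K \<epsilon> 1] q K \<epsilon> by auto
  define R where "R = M * c"
  define a where "a = 1 / (\<omega> * M ^ ?n)"
  define A where "A = {(x, y). x \<in> \<Omega> \<and> y \<in> \<Omega> \<and> dist x y < R * ?\<delta> x \<and> M * ?\<delta> x < ?\<delta> y}"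
  have R: "0 < R" and a: "0 < a" using M c \<omega> by (auto simp: R_def a_def)
  have pos: "0 < ?\<delta> x" if "x \<in> \<Omega>" for x using bdist_pos \<Omega> that by blast
  have sect: "{y. (x, y) \<in> A} \<in> sets lebesgue" for x
  proof -
    have "open (Pair x -` A)" using open_pairs(1)[OF \<Omega>(1), of R M]
      unfolding A_def by (intro open_vimage) (auto intro!: continuous_intros)
    then show ?thesis by (simp add: vimage_def)
  qed
  have large: "ennreal (?\<delta> x ^ ?n) \<le> ennreal a * emeasure lebesgue {y. (x, y) \<in> A}"
    if x: "x \<in> \<Omega>" "ennreal (2 * M / \<kappa> * ?\<delta> x) < ediam \<Omega>" for x
  proof -
    have dx: "0 < ?\<delta> x" using pos x by blast
    obtain z where z: "dist x z \<le> 2 * M / \<kappa> * ?\<delta> x" "ball z (\<kappa> * (2 * M / \<kappa> * ?\<delta> x)) \<subseteq> \<Omega>"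
      using pl[OF _ x(2,1)] dx M \<kappa> by auto
    have z2: "ball z (2 * M * ?\<delta> x) \<subseteq> \<Omega>" using z(2) \<kappa> by simp
    have sub: "ball z (M * ?\<delta> x) \<subseteq> {y. (x, y) \<in> A}"
    proof
      fix y assume "y \<in> ball z (M * ?\<delta> x)"
      then have y: "dist z y < M * ?\<delta> x" by simp
      have "dist z y < 2 * M * ?\<delta> x" using y zero_le_dist[of z y] by linarith
      then have "y \<in> \<Omega>" using z2 by auto
      moreover have "M * ?\<delta> x < ?\<delta> y" using bdist_ge_of_ball_subset[OF \<Omega> z2, of y] y by simp
      moreover have "dist x y < R * ?\<delta> x"
      proof -
        have "dist x y \<le> dist x z + dist z y" by (rule dist_triangle)
        also have "\<dots> < 2 * M / \<kappa> * ?\<delta> x + M * ?\<delta> x" using z(1) y by simp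
        also have "\<dots> = R * ?\<delta> x" by (simp add: R_def c_def algebra_simps)
        finally show ?thesis .
      qed
      ultimately show "y \<in> {y. (x, y) \<in> A}" using x by (simp add: A_def)
    qed
    have "ennreal (?\<delta> x ^ ?n) = ennreal a * ennreal (\<omega> * (M * ?\<delta> x) ^ ?n)"
      using \<omega> M dx by (simp add: a_def ennreal_mult[symmetric] power_mult_distrib)
    also have "\<dots> = ennreal a * emeasure lebesgue (ball z (M * ?\<delta> x))"
      using M dx by (simp add: emeasure_ball \<omega>_def)
    also have "\<dots> \<le> ennreal a * emeasure lebesgue {y. (x, y) \<in> A}"
      by (intro mult_left_mono emeasure_mono sub sect) simp
    finally show ?thesis .
  qed
  have small: "\<exists>V\<ge>0. \<exists>B\<ge>0. B * V \<le> \<epsilon> \<and> emeasure lebesgue {x. (x, y) \<in> A} \<le> ennreal V \<and>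
        (\<forall>x. (x, y) \<in> A \<longrightarrow> a / (?\<delta> x ^ ?n * \<phi> (?\<delta> x)) \<le> B / \<phi> (?\<delta> y))" if y: "y \<in> \<Omega>" for y
  proof -
    define X where "X = ?\<delta> y"
    have X: "0 < X" using pos y by (simp add: X_def)
    define V where "V = C * ((c + 2) * M) powr q * (\<omega> * (2 * (X / M)) ^ ?n)"
    define B where "B = a * (2 * c * M) ^ ?n / (H * M powr (- \<eta>) * (2 * c) powr (- \<bar>\<eta>\<bar>) * X ^ ?n)"
    have "B * V = K * M powr (- (real ?n - \<eta> - q))"
    proof -
      have e1: "M powr (- (real ?n - \<eta> - q)) = M powr q * M powr \<eta> / M ^ ?n"
        using M by (simp add: powr_diff powr_realpow flip: powr_add)
      have e2: "((c + 2) * M) powr q = (c + 2) powr q * M powr q"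
        using M c by (simp add: powr_mult)
      show ?thesis
        unfolding B_def V_def K_def a_def e1 e2 unfolding powr_minus using \<omega> M c X H
        by (simp add: power_mult_distrib power_divide field_simps)
    qed
    then have BV: "B * V \<le> \<epsilon>" using M by simp
    have B0: "0 \<le> B" and V0: "0 \<le> V"
      unfolding B_def V_def using a c M H X C \<omega> by auto
    have cover: "emeasure lebesgue {x. (x, y) \<in> A} \<le> ennreal V"
    proof -
      obtain w where w: "w \<in> frontier \<Omega>" "X = dist y w"
        using bdist_attained[OF \<Omega>(2,3), of y] unfolding X_def by blast
      have XM: "0 < X / M" "X / M < X" using X M by (auto simp: field_simps)
      then have "X / M < (c + 2) * X" using X c by (smt (verit) mult_less_cancel_right2 mult_right_mono)
      then obtain F where F: "covers_by_balls (frontier \<Omega>) (X / M) (ball w ((c + 2) * X) \<inter> frontier \<Omega>) F"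
          "real (card F) \<le> C * ((c + 2) * X / (X / M)) powr q"
        using cov[OF w(1) XM(1)] by blast
      have "{x. (x, y) \<in> A} \<subseteq> (\<Union>z\<in>F. ball z (2 * (X / M)))"
      proof
        fix x assume "x \<in> {x. (x, y) \<in> A}"
        then have x: "x \<in> \<Omega>" "dist x y < R * ?\<delta> x" "M * ?\<delta> x < X" by (auto simp: A_def X_def)
        have dx: "?\<delta> x < X / M" using x(3) M by (simp add: field_simps)
        obtain v where v: "v \<in> frontier \<Omega>" "?\<delta> x = dist x v"
          using bdist_attained[OF \<Omega>(2,3), of x] by blast
        have "R * ?\<delta> x \<le> c * X" using x(3) c unfolding R_def
          by (metis less_eq_real_def mult.assoc mult.commute mult_left_mono order_trans zero_le_one)
        then have "dist w v < (c + 2) * X"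
          using dist_triangle[of w v x] dist_triangle[of w x y] x(2) v(2) w(2) dx XM
          by (simp add: dist_commute algebra_simps)
        then obtain z where z: "z \<in> F" "dist z v < X / M"
          using F(1) v(1) unfolding covers_by_balls_def by (auto simp: subset_iff)
        have "dist z x < 2 * (X / M)"
          using dist_triangle[of z x v] z(2) dx v(2) by (simp add: dist_commute)
        then show "x \<in> (\<Union>z\<in>F. ball z (2 * (X / M)))" using z(1) by auto
      qed
      then have "emeasure lebesgue {x. (x, y) \<in> A} \<le> ennreal (real (card F) * (\<omega> * (2 * (X / M)) ^ ?n))"
        using F(1) XM unfolding \<omega>_def
        by (intro emeasure_le_of_cover_by_balls) (auto simp: covers_by_balls_def)
      also have "\<dots> \<le> ennreal V"
      proof (intro ennreal_leI)
        have "(c + 2) * X / (X / M) = (c + 2) * M" using X M by (simp add: field_simps)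
        then show "real (card F) * (\<omega> * (2 * (X / M)) ^ ?n) \<le> V"
          unfolding V_def using F(2) \<omega> X M by (intro mult_right_mono) auto
      qed
      finally show ?thesis .
    qed
    have ptw: "a / (?\<delta> x ^ ?n * \<phi> (?\<delta> x)) \<le> B / \<phi> X" if "(x, y) \<in> A" for x
    proof -
      have x: "x \<in> \<Omega>" "dist x y < R * ?\<delta> x" "M * ?\<delta> x < X" using that by (auto simp: A_def X_def)
      define Z where "Z = ?\<delta> x"
      have Z: "0 < Z" using pos x by (simp add: Z_def)
      have ZX: "Z \<le> X" proof -
        have "1 * Z \<le> M * Z" using M Z by (intro mult_right_mono) auto
        then show ?thesis using x(3) unfolding Z_def by linarith
      qed
      have "1 \<le> M * c" using M c mult_mono[of 1 M 1 c] by simp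
      then have "1 * Z \<le> (M * c) * Z" using Z by (intro mult_right_mono) auto
      moreover have "X < Z + (M * c) * Z"
        using bdist_Lipschitz[of \<Omega> y x] x(2) unfolding X_def Z_def R_def by (simp add: dist_commute)
      ultimately have XZ: "X < 2 * c * M * Z" by (simp add: algebra_simps)
      \<comment> \<open>The ratio \<open>Z / X\<close> of the two depths is \<open>1 / M\<close> up to a factor between \<open>1 / (2 * c)\<close> and 1, so
        the sign of \<open>\<eta>\<close> does not matter when \<open>M\<close> is taken out of the power.\<close>
      have "(2 * c) powr (- \<bar>\<eta>\<bar>) \<le> (M * Z / X) powr \<eta>"
      proof (rule powr_ge_of_ratio_bounds)
        show "1 \<le> 2 * c" using c by simp
        show "1 / (2 * c) \<le> M * Z / X" using XZ X c by (simp add: field_simps)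
        have "M * Z / X \<le> 1" using x(3) X by (simp add: Z_def)
        then show "M * Z / X \<le> 2 * c" using c by simp
      qed
      then have "M powr (- \<eta>) * (2 * c) powr (- \<bar>\<eta>\<bar>) \<le> M powr (- \<eta>) * (M * Z / X) powr \<eta>"
        by (intro mult_left_mono) auto
      also have "\<dots> = (Z / X) powr \<eta>"
        using M X Z by (simp add: powr_minus powr_mult powr_divide field_simps)
      finally have "H * (M powr (- \<eta>) * (2 * c) powr (- \<bar>\<eta>\<bar>)) * \<phi> X \<le> H * (Z / X) powr \<eta> * \<phi> X"
        using H WUSC0_D(1)[OF \<phi> X] by (intro mult_right_mono mult_left_mono) auto
      also have "\<dots> \<le> \<phi> Z" by (rule WUSC0_D(2)[OF \<phi> Z ZX])
      finally have \<phi>Z: "H * (M powr (- \<eta>) * (2 * c) powr (- \<bar>\<eta>\<bar>)) * \<phi> X \<le> \<phi> Z" .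
      have "X / (2 * c * M) \<le> Z" using XZ M c by (simp add: pos_divide_le_eq mult.commute)
      then have Zn: "(X / (2 * c * M)) ^ ?n \<le> Z ^ ?n"
        using X M c by (intro power_mono) auto
      have "a / (Z ^ ?n * \<phi> Z)
          \<le> a / ((X / (2 * c * M)) ^ ?n * (H * (M powr (- \<eta>) * (2 * c) powr (- \<bar>\<eta>\<bar>)) * \<phi> X))"
        using a X M c H WUSC0_D(1)[OF \<phi> X] Z
        by (intro divide_left_mono mult_mono Zn \<phi>Z mult_pos_pos) (auto intro: WUSC0_D(1)[OF \<phi>])
      also have "\<dots> = B / \<phi> X" unfolding B_def using X M c by (simp add: power_divide)
      finally show ?thesis by (simp add: Z_def)
    qed
    show ?thesis using B0 V0 BV cover ptw unfolding X_def by blast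
  qed
  have "averaging_kernel \<Omega> \<phi> {x \<in> \<Omega>. ennreal (2 * M / \<kappa> * ?\<delta> x) < ediam \<Omega>} \<epsilon> a R A"
    unfolding averaging_kernel_def using a R large small open_pairs(1)[OF \<Omega>(1), of R M]
    by (auto simp: A_def)
  moreover have "0 < 2 * M / \<kappa>" using M \<kappa> by simp
  ultimately show thesis using that by blast
qed

text \<open>Average over points that are about \<open>M\<close> times shallower. The boundary within distance \<open>\<delta>(x)\<close> of a
  point nearest to \<open>x\<close> contains, for an admissible exponent \<open>t\<close> of the lower
  dimension, at least a constant times \<open>M powr t\<close> points that are
  \<open>\<delta>(x) / M\<close>-separated, and plumpness at each of them gives a ball in \<open>\<Omega>\<close> of radius comparable to
  \<open>\<delta>(x) / M\<close>, whose inner part has depth of the same order. The set averaged over thus has volume at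
  least a constant times \<open>M powr (t - d) * \<delta>(x) ^ d\<close>. The points \<open>x\<close> that use a given \<open>y\<close> lie in a
  ball around \<open>y\<close> of radius comparable to their own depth, which is comparable to \<open>M \<delta>(y)\<close>, and their
  weight is at most \<open>M powr (- \<eta>)\<close> times that of \<open>y\<close>, up to a constant. The mass sent to \<open>y\<close>
  has relative size \<open>M powr (d - t - \<eta>)\<close>, and \<open>t\<close> can be taken above \<open>d - \<eta>\<close>.\<close>

lemma kernel_towards_boundary:
  fixes \<Omega> :: "'a::euclidean_space set"
  assumes \<Omega>: "open \<Omega>" "\<Omega> \<noteq> {}" "\<Omega> \<noteq> UNIV" and plump: "plump \<kappa> \<Omega>"
    and H: "0 < H" and \<phi>: "\<phi> \<in> WLSC0 \<eta> H"
    and dim: "ereal (real DIM('a) - \<eta>) < lower_Assouad_dim (frontier \<Omega>)"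
    and bdd: "bounded \<Omega> \<or> \<not> bounded (frontier \<Omega>)"
    and \<epsilon>: "0 < \<epsilon>"
  obtains a R A where "averaging_kernel \<Omega> \<phi> \<Omega> \<epsilon> a R A"
proof -
  let ?n = "DIM('a)" and ?\<delta> = "bdist \<Omega>"
  define \<omega> where "\<omega> = unit_ball_vol (real ?n)"
  have \<omega>: "0 < \<omega>" by (simp add: \<omega>_def)
  have \<kappa>: "0 < \<kappa>" "\<kappa> < 1"
    and pl: "\<And>r x. 0 < r \<Longrightarrow> ennreal r < ediam \<Omega> \<Longrightarrow> x \<in> closure \<Omega> \<Longrightarrow> \<exists>z\<in>cball x r. ball z (\<kappa> * r) \<subseteq> \<Omega>"
    using plump unfolding plump_def by auto
  obtain t c0 where t: "real ?n - \<eta> < t" and c0: "0 < c0"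
    and many: "\<And>x r \<rho> F. x \<in> frontier \<Omega> \<Longrightarrow> 0 < r \<Longrightarrow> r < \<rho> \<Longrightarrow> ennreal \<rho> < ediam (frontier \<Omega>) \<Longrightarrow>
        covers_by_balls (frontier \<Omega>) r (ball x \<rho> \<inter> frontier \<Omega>) F \<Longrightarrow> c0 * (\<rho> / r) powr t \<le> real (card F)"
    using dim unfolding lower_Assouad_dim_def less_Sup_iff by auto
  define K where "K = (8 / \<kappa>) ^ ?n * (24 / \<kappa>) ^ ?n * (8 / \<kappa>) powr \<bar>\<eta>\<bar> / (c0 * H)"
  have K: "0 < K" unfolding K_def using c0 \<kappa> H by simp
  obtain M where M: "1 < M" "K * M powr (- (t + \<eta> - real ?n)) \<le> \<epsilon>"
    using exists_large_powr_le[of "t + \<eta> - real ?n" K \<epsilon> 1] t K \<epsilon> by auto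
  define a where "a = M ^ ?n / (c0 * M powr t * \<omega> * (\<kappa> / 8) ^ ?n)"
  define A where "A = {(x, y). x \<in> \<Omega> \<and> y \<in> \<Omega> \<and> dist x y < 3 * ?\<delta> x \<and>
    \<kappa> / (8 * M) * ?\<delta> x < ?\<delta> y \<and> ?\<delta> y < 1 / M * ?\<delta> x}"
  have a: "0 < a" using M c0 \<omega> \<kappa> by (auto simp: a_def)
  have openA: "open A" unfolding A_def by (rule open_pairs(2)[OF \<Omega>(1)])
  have pos: "0 < ?\<delta> x" if "x \<in> \<Omega>" for x using bdist_pos \<Omega> that by blast
  have sect: "{y. (x, y) \<in> A} \<in> sets lebesgue" for x
  proof -
    have "open (Pair x -` A)" using openA
      by (intro open_vimage) (auto intro!: continuous_intros)
    then show ?thesis by (simp add: vimage_def)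
  qed
  have large: "ennreal (?\<delta> x ^ ?n) \<le> ennreal a * emeasure lebesgue {y. (x, y) \<in> A}" if x: "x \<in> \<Omega>" for x
  proof -
    define D where "D = ?\<delta> x"
    have D: "0 < D" using pos x by (simp add: D_def)
    define s where "s = D / M"
    have s: "0 < s" "s < D" using D M by (auto simp: s_def field_simps)
    obtain w where w: "w \<in> frontier \<Omega>" "D = dist x w"
      using bdist_attained[OF \<Omega>(2,3), of x] unfolding D_def by blast
    obtain P where P: "finite P" "P \<subseteq> ball w D \<inter> frontier \<Omega>"
      "\<And>v v'. v \<in> P \<Longrightarrow> v' \<in> P \<Longrightarrow> v \<noteq> v' \<Longrightarrow> s \<le> dist v v'"
      "ball w D \<inter> frontier \<Omega> \<subseteq> (\<Union>v\<in>P. ball v s)"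
      using exists_separated_net[of "ball w D \<inter> frontier \<Omega>" s] s bounded_subset[OF bounded_ball] by (metis inf_le1)
    have "ennreal D < ediam (frontier \<Omega>)"
      using bdist_less_ediam_frontier[OF \<Omega>(1,3) x bdd] by (simp add: D_def)
    moreover have "covers_by_balls (frontier \<Omega>) s (ball w D \<inter> frontier \<Omega>) P"
      using P unfolding covers_by_balls_def by blast
    ultimately have "c0 * (D / s) powr t \<le> real (card P)"
      using many[OF w(1) s] by blast
    moreover have "D / s = M" using D M by (simp add: s_def)
    ultimately have card: "c0 * M powr t \<le> real (card P)" by simp
    have "\<forall>v\<in>P. \<exists>z. dist v z \<le> s / 4 \<and> ball z (\<kappa> * (s / 4)) \<subseteq> \<Omega>"
    proof
      fix v assume "v \<in> P"
      then have "v \<in> closure \<Omega>" using P(2) by (auto simp: frontier_def)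
      moreover have "ennreal (s / 4) < ediam \<Omega>"
        using less_ediam_of_less_bdist[OF x, of "s/4"] s by (simp add: D_def)
      ultimately show "\<exists>z. dist v z \<le> s / 4 \<and> ball z (\<kappa> * (s / 4)) \<subseteq> \<Omega>"
        using pl[of "s/4" v] s by auto
    qed
    then obtain z where z: "\<And>v. v \<in> P \<Longrightarrow> dist v (z v) \<le> s / 4"
      "\<And>v. v \<in> P \<Longrightarrow> ball (z v) (\<kappa> * (s / 4)) \<subseteq> \<Omega>" by metis
    \<comment> \<open>Halving the radius of the plump balls keeps their points at depth more than \<open>\<kappa> * s / 8\<close>;
      plumpness at scale \<open>s / 4\<close> keeps balls of \<open>s\<close>-separated centres disjoint.\<close>
    have \<kappa>s: "0 < \<kappa> * s" "\<kappa> * s < s" using \<kappa> s by auto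
    have near: "dist v y < 3 / 8 * s" if "v \<in> P" "y \<in> ball (z v) (\<kappa> * s / 8)" for v y
    proof -
      have "dist v y \<le> dist v (z v) + dist (z v) y" by (rule dist_triangle)
      also have "\<dots> < s / 4 + s / 8" using z(1)[OF that(1)] that(2) \<kappa>s by auto
      finally show ?thesis by simp
    qed
    have "ennreal (real (card P) * (\<omega> * (\<kappa> * s / 8) ^ ?n)) \<le> emeasure lebesgue {y. (x, y) \<in> A}"
      unfolding \<omega>_def
    proof (rule emeasure_ge_of_disjoint_balls[OF P(1) _ _ sect])
      show "disjoint_family_on (\<lambda>v. ball (z v) (\<kappa> * s / 8)) P"
      proof (unfold disjoint_family_on_def, intro ballI impI, rule ccontr)
        fix v v' assume v: "v \<in> P" "v' \<in> P" "v \<noteq> v'"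
          and "ball (z v) (\<kappa> * s / 8) \<inter> ball (z v') (\<kappa> * s / 8) \<noteq> {}"
        then obtain y where "y \<in> ball (z v) (\<kappa> * s / 8)" "y \<in> ball (z v') (\<kappa> * s / 8)" by blast
        then have "dist v y < 3 / 8 * s" "dist v' y < 3 / 8 * s" using near v by auto
        then show False using P(3)[OF v] dist_triangle2[of v v' y] s by simp
      qed
      show "(\<Union>v\<in>P. ball (z v) (\<kappa> * s / 8)) \<subseteq> {y. (x, y) \<in> A}"
      proof
        fix y assume "y \<in> (\<Union>v\<in>P. ball (z v) (\<kappa> * s / 8))"
        then obtain v where v: "v \<in> P" "y \<in> ball (z v) (\<kappa> * s / 8)" by blast
        have vy: "dist v y < 3 / 8 * s" using near v by blast
        have vw: "v \<in> frontier \<Omega>" "dist w v < D" using P(2) v(1) by auto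
        have "dist (z v) y < \<kappa> * (s / 4)" using v(2) \<kappa>s by simp
        then have "y \<in> \<Omega>" using z(2)[OF v(1)] by auto
        moreover have "dist x y < 3 * D"
          using dist_triangle[of x y w] dist_triangle[of w y v] vy vw(2) w(2) s by simp
        moreover have "?\<delta> y < 1 / M * D"
          using bdist_le[OF vw(1), of y] vy s by (simp add: dist_commute s_def)
        moreover have "\<kappa> / (8 * M) * D < ?\<delta> y"
          using bdist_ge_of_ball_subset[OF \<Omega> z(2)[OF v(1)], of y] v(2)
          by (simp add: s_def)
        ultimately show "y \<in> {y. (x, y) \<in> A}" using x by (simp add: A_def D_def)
      qed
      show "0 \<le> \<kappa> * s / 8" using \<kappa>s by simp
    qed
    moreover have "D ^ ?n = a * (c0 * M powr t * (\<omega> * (\<kappa> * s / 8) ^ ?n))"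
      using M c0 \<omega> \<kappa> unfolding a_def s_def by (simp add: power_mult_distrib power_divide)
    moreover have "c0 * M powr t * (\<omega> * (\<kappa> * s / 8) ^ ?n) \<le> real (card P) * (\<omega> * (\<kappa> * s / 8) ^ ?n)"
      using card \<omega> \<kappa>s by (intro mult_right_mono) auto
    ultimately have "ennreal (c0 * M powr t * (\<omega> * (\<kappa> * s / 8) ^ ?n)) \<le> emeasure lebesgue {y. (x, y) \<in> A}"
      using ennreal_leI order_trans by blast
    then have "ennreal a * ennreal (c0 * M powr t * (\<omega> * (\<kappa> * s / 8) ^ ?n))
        \<le> ennreal a * emeasure lebesgue {y. (x, y) \<in> A}" by (intro mult_left_mono) auto
    then show ?thesis
      using \<open>D ^ ?n = _\<close> a c0 \<omega> \<kappa>s by (simp add: D_def ennreal_mult[symmetric])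
  qed
  have small: "\<exists>V\<ge>0. \<exists>B\<ge>0. B * V \<le> \<epsilon> \<and> emeasure lebesgue {x. (x, y) \<in> A} \<le> ennreal V \<and>
        (\<forall>x. (x, y) \<in> A \<longrightarrow> a / (?\<delta> x ^ ?n * \<phi> (?\<delta> x)) \<le> B / \<phi> (?\<delta> y))" if y: "y \<in> \<Omega>" for y
  proof -
    define X where "X = ?\<delta> y"
    have X: "0 < X" using pos y by (simp add: X_def)
    define V where "V = \<omega> * (24 * M / \<kappa> * X) ^ ?n"
    define B where "B = a / ((M * X) ^ ?n * (H * (M powr \<eta> * (8 / \<kappa>) powr (- \<bar>\<eta>\<bar>))))"
    have "B * V = K * M powr (- (t + \<eta> - real ?n))"
    proof -
      have e1: "M powr (- (t + \<eta> - real ?n)) = M ^ ?n / (M powr t * M powr \<eta>)"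
        using M by (simp add: powr_diff powr_realpow flip: powr_add)
      show ?thesis
        unfolding B_def V_def K_def a_def e1 unfolding powr_minus using \<omega> M \<kappa> X H c0
        by (simp add: power_mult_distrib power_divide field_simps)
    qed
    then have BV: "B * V \<le> \<epsilon>" using M by simp
    have B0: "0 \<le> B" and V0: "0 \<le> V"
      unfolding B_def V_def using a M H X \<omega> \<kappa> by auto
    have x_bounds: "x \<in> \<Omega>" "dist x y < 3 * ?\<delta> x" "?\<delta> x < 8 * M / \<kappa> * X" "M * X < ?\<delta> x"
      if "(x, y) \<in> A" for x
      using that M \<kappa> by (auto simp: A_def X_def field_simps)
    have cover: "emeasure lebesgue {x. (x, y) \<in> A} \<le> ennreal V"
    proof -
      have "{x. (x, y) \<in> A} \<subseteq> ball y (24 * M / \<kappa> * X)"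
      proof
        fix x assume "x \<in> {x. (x, y) \<in> A}"
        then show "x \<in> ball y (24 * M / \<kappa> * X)"
          using x_bounds(2,3)[of x] by (simp add: dist_commute)
      qed
      then have "emeasure lebesgue {x. (x, y) \<in> A} \<le> emeasure lebesgue (ball y (24 * M / \<kappa> * X))"
        by (intro emeasure_mono) auto
      also have "\<dots> = ennreal V" using M \<kappa> X by (simp add: emeasure_ball V_def \<omega>_def)
      finally show ?thesis .
    qed
    have ptw: "a / (?\<delta> x ^ ?n * \<phi> (?\<delta> x)) \<le> B / \<phi> X" if "(x, y) \<in> A" for x
    proof -
      note x = x_bounds[OF that]
      define Z where "Z = ?\<delta> x"
      have Z: "0 < Z" using pos x by (simp add: Z_def)
      have MX: "0 < M * X" using M X by simp
      have XZ: "X \<le> Z" proof -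
        have "1 * X \<le> M * X" using M X by (intro mult_right_mono) auto
        then show ?thesis using x(4) unfolding Z_def by linarith
      qed
      have "(8 / \<kappa>) powr (- \<bar>\<eta>\<bar>) \<le> (Z / (M * X)) powr \<eta>"
      proof (rule powr_ge_of_ratio_bounds)
        show "1 \<le> 8 / \<kappa>" using \<kappa> by simp
        have "1 / (8 / \<kappa>) \<le> 1" using \<kappa> by simp
        also have "1 \<le> Z / (M * X)" using x(4) MX by (simp add: Z_def)
        finally show "1 / (8 / \<kappa>) \<le> Z / (M * X)" .
        show "Z / (M * X) \<le> 8 / \<kappa>" using x(3) MX M X \<kappa> by (simp add: Z_def field_simps)
      qed
      then have "M powr \<eta> * (8 / \<kappa>) powr (- \<bar>\<eta>\<bar>) \<le> M powr \<eta> * (Z / (M * X)) powr \<eta>"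
        by (intro mult_left_mono) auto
      also have "\<dots> = (Z / X) powr \<eta>"
        using M X Z by (simp add: powr_mult powr_divide)
      finally have "H * (M powr \<eta> * (8 / \<kappa>) powr (- \<bar>\<eta>\<bar>)) * \<phi> X \<le> H * (Z / X) powr \<eta> * \<phi> X"
        using H WLSC0_D(1)[OF \<phi> X] by (intro mult_right_mono mult_left_mono) auto
      also have "\<dots> \<le> \<phi> Z" by (rule WLSC0_D(2)[OF \<phi> X XZ])
      finally have \<phi>Z: "H * (M powr \<eta> * (8 / \<kappa>) powr (- \<bar>\<eta>\<bar>)) * \<phi> X \<le> \<phi> Z" .
      have Zn: "(M * X) ^ ?n \<le> Z ^ ?n" using MX x(4) by (intro power_mono) (auto simp: Z_def)
      have "a / (Z ^ ?n * \<phi> Z)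
          \<le> a / ((M * X) ^ ?n * (H * (M powr \<eta> * (8 / \<kappa>) powr (- \<bar>\<eta>\<bar>)) * \<phi> X))"
        using a X M \<kappa> H WLSC0_D(1)[OF \<phi> X] Z
        by (intro divide_left_mono mult_mono Zn \<phi>Z mult_pos_pos) (auto intro: WLSC0_D(1)[OF \<phi>])
      also have "\<dots> = B / \<phi> X" unfolding B_def by simp
      finally show ?thesis by (simp add: Z_def)
    qed
    show ?thesis using B0 V0 BV cover ptw unfolding X_def by blast
  qed
  have "averaging_kernel \<Omega> \<phi> \<Omega> \<epsilon> a 3 A"
    unfolding averaging_kernel_def using a large small openA
    by (auto simp: A_def)
  then show thesis using that by blast
qed

section \<open>Averaging and absorption\<close>

lemma abs_powr_le_add:
  fixes a b p :: real
  assumes "0 < p"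
  shows "\<bar>a\<bar> powr p \<le> 2 powr p * (\<bar>a - b\<bar> powr p + \<bar>b\<bar> powr p)"
proof -
  define m where "m = max \<bar>a - b\<bar> \<bar>b\<bar>"
  have "\<bar>a - b\<bar> \<le> m" "\<bar>b\<bar> \<le> m" by (simp_all add: m_def)
  then have "\<bar>a\<bar> \<le> 2 * m" by linarith
  then have "\<bar>a\<bar> powr p \<le> (2 * m) powr p"
    using assms by (intro powr_mono2) auto
  also have "\<dots> = 2 powr p * m powr p" by (simp add: powr_mult m_def)
  also have "\<dots> \<le> 2 powr p * (\<bar>a - b\<bar> powr p + \<bar>b\<bar> powr p)"
    by (intro mult_left_mono) (auto simp: m_def max_def)
  finally show ?thesis .
qed

lemma sigma_finite_lebesgue: "sigma_finite_measure (lebesgue :: 'a::euclidean_space measure)"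
proof
  obtain S :: "'a set set" where "countable S" "S \<subseteq> sets lborel" "\<Union>S = space lborel"
    "\<forall>a\<in>S. emeasure lborel a \<noteq> \<infinity>"
    using lborel.sigma_finite_countable by blast
  then show "\<exists>A::'a set set. countable A \<and> A \<subseteq> sets lebesgue \<and> \<Union> A = space lebesgue \<and> (\<forall>a\<in>A. emeasure lebesgue a \<noteq> \<infinity>)"
    by (intro exI[of _ S]) auto
qed

lemma open_sets_lebesgue_product:
  fixes A :: "('a::euclidean_space \<times> 'a) set"
  assumes "open A"
  shows "A \<in> sets (lebesgue \<Otimes>\<^sub>M lebesgue)"
proof -
  have "(\<lambda>p. (fst p, snd p)) \<in> (lebesgue \<Otimes>\<^sub>M lebesgue) \<rightarrow>\<^sub>M (borel \<Otimes>\<^sub>M (borel :: 'a measure))"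
    by (intro measurable_Pair measurable_compose[OF measurable_fst] measurable_compose[OF measurable_snd]
        measurable_completion) (simp_all add: measurable_ident_sets)
  moreover have "A \<in> sets (borel \<Otimes>\<^sub>M (borel :: 'a measure))"
    using assms unfolding borel_prod by simp
  ultimately have "(\<lambda>p. (fst p, snd p)) -` A \<inter> space (lebesgue \<Otimes>\<^sub>M lebesgue) \<in> sets (lebesgue \<Otimes>\<^sub>M lebesgue)"
    by (rule measurable_sets)
  then show ?thesis by (simp add: space_pair_measure)
qed

definition weighted_norm :: "'a::euclidean_space set \<Rightarrow> (real \<Rightarrow> real) \<Rightarrow> real \<Rightarrow> ('a \<Rightarrow> real) \<Rightarrow> ennreal" where
  "weighted_norm \<Omega> \<phi> p u = (\<integral>\<^sup>+x\<in>\<Omega>. ennreal (\<bar>u x\<bar> powr p / \<phi> (bdist \<Omega> x)) \<partial>lebesgue)"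

definition local_seminorm ::
    "'a::euclidean_space set \<Rightarrow> (real \<Rightarrow> real) \<Rightarrow> real \<Rightarrow> real \<Rightarrow> ('a \<Rightarrow> real) \<Rightarrow> ennreal" where
  "local_seminorm \<Omega> \<phi> p R u =
     (\<integral>\<^sup>+x\<in>\<Omega>. (\<integral>\<^sup>+y\<in>\<Omega> \<inter> ball x (R * bdist \<Omega> x).
        ennreal (\<bar>u x - u y\<bar> powr p / (\<phi> (bdist \<Omega> x) * bdist \<Omega> x ^ DIM('a))) \<partial>lebesgue) \<partial>lebesgue)"

text \<open>The final step of the averaging argument. It is here that the left hand side of the Hardy
  inequality has to be finite.\<close>

lemma ennreal_absorb_half:
  fixes I Z :: ennreal
  assumes "I \<le> Z + ennreal (1 / 2) * I" "I < \<infinity>"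
  shows "I \<le> 2 * Z"
proof (cases "Z = \<infinity>")
  case True
  then show ?thesis by (simp add: ennreal_mult_top)
next
  case False
  obtain i where i: "0 \<le> i" "I = ennreal i" using assms(2) by (cases I) auto
  obtain z where z: "0 \<le> z" "Z = ennreal z" using False by (cases Z) auto
  have "ennreal (z + 1 / 2 * i) = ennreal z + ennreal (1 / 2 * i)" using i z by (intro ennreal_plus) auto
  also have "ennreal (1 / 2 * i) = ennreal (1 / 2) * ennreal i" using i by (intro ennreal_mult) auto
  finally have "ennreal i \<le> ennreal (z + 1 / 2 * i)" using assms(1) i z by simp
  then have "i \<le> z + 1 / 2 * i" using i z by (subst (asm) ennreal_le_iff) auto
  then have "i \<le> 2 * z" by simp
  then have "ennreal i \<le> ennreal (2 * z)" by (rule ennreal_leI)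
  then show ?thesis using i z by (simp add: ennreal_mult)
qed

text \<open>On \<open>G\<close>, the weighted integral of \<open>\<bar>u x\<bar> powr p\<close> is at most its average against the kernel, and
  there \<open>u x\<close> is replaced by \<open>u x - u y\<close> and \<open>u y\<close>. Tonelli's theorem turns the integral of
  \<open>\<bar>u y\<bar> powr p\<close> into one against the mass that is sent to \<open>y\<close>, at most \<open>\<epsilon> = 1 / (2 * 2 powr p)\<close>
  times the weight of \<open>y\<close>; together with the factor \<open>2 powr p\<close> this is half of the left hand side.\<close>

lemma averaging_inequality_measurable:
  fixes \<Omega> :: "'a::euclidean_space set" and u :: "'a \<Rightarrow> real"
  assumes \<Omega>: "open \<Omega>" "\<Omega> \<noteq> UNIV" and p: "0 < p"
    and ker: "averaging_kernel \<Omega> \<phi> G (1 / (2 * 2 powr p)) a R A"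
    and \<phi>: "\<phi> \<in> borel_measurable borel" "\<And>s. 0 < s \<Longrightarrow> 0 < \<phi> s"
    and u: "u \<in> borel_measurable (lebesgue_on \<Omega>)"
    and G: "G \<subseteq> \<Omega>" "G \<in> sets lebesgue"
    and fin: "weighted_norm \<Omega> \<phi> p u < \<infinity>"
  shows "weighted_norm \<Omega> \<phi> p u \<le> ennreal (2 * (2 powr p * a)) * local_seminorm \<Omega> \<phi> p R u
     + 2 * (\<integral>\<^sup>+x\<in>\<Omega> - G. ennreal (\<bar>u x\<bar> powr p / \<phi> (bdist \<Omega> x)) \<partial>lebesgue)"
proof -
  let ?n = "DIM('a)" and ?\<delta> = "bdist \<Omega>"
  interpret S: sigma_finite_measure "lebesgue :: 'a measure" by (rule sigma_finite_lebesgue)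
  interpret P: pair_sigma_finite "lebesgue :: 'a measure" "lebesgue :: 'a measure" ..
  have pos: "0 < ?\<delta> x" "0 < \<phi> (?\<delta> x)" if "x \<in> \<Omega>" for x
    using bdist_pos[OF \<Omega> that] \<phi>(2) by auto
  have A: "open A" "0 < a" "0 < R" "\<And>x y. (x, y) \<in> A \<Longrightarrow> x \<in> \<Omega> \<and> y \<in> \<Omega> \<and> dist x y < R * ?\<delta> x"
    and large: "\<And>x. x \<in> G \<Longrightarrow> ennreal (?\<delta> x ^ ?n) \<le> ennreal a * emeasure lebesgue {y. (x, y) \<in> A}"
    and small: "\<And>y. y \<in> \<Omega> \<Longrightarrow> \<exists>V\<ge>0. \<exists>B\<ge>0. B * V \<le> 1 / (2 * 2 powr p) \<and>
        emeasure lebesgue {x. (x, y) \<in> A} \<le> ennreal V \<and>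
        (\<forall>x. (x, y) \<in> A \<longrightarrow> a / (?\<delta> x ^ ?n * \<phi> (?\<delta> x)) \<le> B / \<phi> (?\<delta> y))"
    using ker unfolding averaging_kernel_def by auto
  have Asets[measurable]: "A \<in> sets (lebesgue \<Otimes>\<^sub>M lebesgue)" by (rule open_sets_lebesgue_product[OF A(1)])
  have sect1[measurable]: "{y. (x, y) \<in> A} \<in> sets lebesgue" for x
    using sets_Pair1[OF Asets, of x] by (simp add: vimage_def)
  have sect2[measurable]: "{x. (x, y) \<in> A} \<in> sets lebesgue" for y
    using sets_Pair2[OF Asets, of y] by (simp add: vimage_def)
  have [measurable]: "\<Omega> \<in> sets lebesgue" "G \<in> sets lebesgue" using \<Omega>(1) G(2) by auto
  define v where "v = (\<lambda>x. if x \<in> \<Omega> then u x else 0)"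
  have v[measurable]: "v \<in> borel_measurable lebesgue"
    unfolding v_def by (rule borel_measurable_if_I[OF u]) simp
  have \<delta>b: "?\<delta> \<in> borel_measurable borel"
    by (rule borel_measurable_continuous_onI[OF continuous_bdist])
  have [measurable]: "?\<delta> \<in> borel_measurable lebesgue" "(\<lambda>x. \<phi> (?\<delta> x)) \<in> borel_measurable lebesgue"
    using \<delta>b measurable_compose[OF \<delta>b \<phi>(1)] by (auto intro!: measurable_completion)
  define f where "f = (\<lambda>x. ennreal (\<bar>v x\<bar> powr p))"
  define g where "g = (\<lambda>x y. ennreal (\<bar>v x - v y\<bar> powr p))"
  define W where "W = (\<lambda>x. indicator \<Omega> x * ennreal (1 / \<phi> (?\<delta> x)))"
  define k where "k = (\<lambda>x y. indicator A (x, y) * ennreal (1 / ?\<delta> x ^ ?n))"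
  have [measurable]: "f \<in> borel_measurable lebesgue" "W \<in> borel_measurable lebesgue"
    unfolding f_def W_def by measurable
  have [measurable]: "(\<lambda>(x, y). g x y) \<in> borel_measurable (lebesgue \<Otimes>\<^sub>M lebesgue)"
    "(\<lambda>(x, y). k x y) \<in> borel_measurable (lebesgue \<Otimes>\<^sub>M lebesgue)"
    unfolding g_def k_def by measurable
  define I where "I = weighted_norm \<Omega> \<phi> p u"
  define Y where "Y = (\<integral>\<^sup>+x\<in>\<Omega> - G. ennreal (\<bar>u x\<bar> powr p / \<phi> (?\<delta> x)) \<partial>lebesgue)"
  have fW: "f x * W x = ennreal (\<bar>u x\<bar> powr p / \<phi> (?\<delta> x)) * indicator \<Omega> x" for x
    using pos[of x] by (auto simp: f_def W_def v_def ennreal_mult[symmetric] indicator_def)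
  have I: "I = (\<integral>\<^sup>+x. f x * W x \<partial>lebesgue)"
    unfolding I_def weighted_norm_def fW ..
  have Y: "Y = (\<integral>\<^sup>+x. f x * W x * indicator (\<Omega> - G) x \<partial>lebesgue)"
    unfolding Y_def fW by (intro nn_integral_cong) (auto simp: indicator_def)
  have mass: "1 \<le> (\<integral>\<^sup>+y. ennreal a * k x y \<partial>lebesgue)" if x: "x \<in> G" for x
  proof -
    have dx: "0 < ?\<delta> x" using pos G x by auto
    have "(\<integral>\<^sup>+y. ennreal a * k x y \<partial>lebesgue)
        = (\<integral>\<^sup>+y. ennreal (a / ?\<delta> x ^ ?n) * indicator {y. (x, y) \<in> A} y \<partial>lebesgue)"
      unfolding k_def using A(2) dx
      by (intro nn_integral_cong) (auto simp: indicator_def ennreal_mult[symmetric])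
    also have "\<dots> = ennreal (a / ?\<delta> x ^ ?n) * emeasure lebesgue {y. (x, y) \<in> A}"
      by (rule nn_integral_cmult_indicator) (rule sect1)
    also have "\<dots> = ennreal (1 / ?\<delta> x ^ ?n) * (ennreal a * emeasure lebesgue {y. (x, y) \<in> A})"
      using A(2) dx by (simp add: ennreal_mult[symmetric] mult.assoc[symmetric])
    also have "\<dots> \<ge> ennreal (1 / ?\<delta> x ^ ?n) * ennreal (?\<delta> x ^ ?n)"
      using large[OF x] by (rule mult_left_mono) simp
    also have "ennreal (1 / ?\<delta> x ^ ?n) * ennreal (?\<delta> x ^ ?n) = 1"
      using dx by (simp add: ennreal_mult[symmetric])
    finally show ?thesis .
  qed
  have transported: "(\<integral>\<^sup>+x. W x * (ennreal a * k x y) \<partial>lebesgue) \<le> ennreal (1 / (2 * 2 powr p)) * W y" for y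
  proof (cases "y \<in> \<Omega>")
    case False
    then have "k x y = 0" for x using A(4) by (auto simp: k_def indicator_def)
    then show ?thesis by simp
  next
    case True
    obtain V B where VB: "0 \<le> V" "0 \<le> B" "B * V \<le> 1 / (2 * 2 powr p)"
        "emeasure lebesgue {x. (x, y) \<in> A} \<le> ennreal V"
        and ptw: "\<And>x. (x, y) \<in> A \<Longrightarrow> a / (?\<delta> x ^ ?n * \<phi> (?\<delta> x)) \<le> B / \<phi> (?\<delta> y)"
      using small[OF True] by blast
    have "(\<integral>\<^sup>+x. W x * (ennreal a * k x y) \<partial>lebesgue)
        \<le> (\<integral>\<^sup>+x. ennreal (B / \<phi> (?\<delta> y)) * indicator {x. (x, y) \<in> A} x \<partial>lebesgue)"
    proof (rule nn_integral_mono)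
      fix x
      show "W x * (ennreal a * k x y) \<le> ennreal (B / \<phi> (?\<delta> y)) * indicator {x. (x, y) \<in> A} x"
      proof (cases "(x, y) \<in> A")
        case True
        then have x: "x \<in> \<Omega>" using A(4) by blast
        have "W x * (ennreal a * k x y) = ennreal (a / (?\<delta> x ^ ?n * \<phi> (?\<delta> x)))"
          using True x pos[OF x] A(2) by (simp add: W_def k_def ennreal_mult[symmetric] mult.commute)
        then show ?thesis using ptw[OF True] True by (simp add: ennreal_leI)
      qed (simp add: k_def)
    qed
    also have "\<dots> = ennreal (B / \<phi> (?\<delta> y)) * emeasure lebesgue {x. (x, y) \<in> A}"
      by (rule nn_integral_cmult_indicator) (rule sect2)
    also have "\<dots> \<le> ennreal (B / \<phi> (?\<delta> y)) * ennreal V" using VB(4) by (rule mult_left_mono) simp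
    also have "\<dots> = ennreal (B * V * (1 / \<phi> (?\<delta> y)))"
      using VB pos[OF True] by (simp add: ennreal_mult[symmetric])
    also have "\<dots> \<le> ennreal (1 / (2 * 2 powr p) * (1 / \<phi> (?\<delta> y)))"
      using VB(3) pos[OF True] by (intro ennreal_leI mult_right_mono) auto
    also have "\<dots> = ennreal (1 / (2 * 2 powr p)) * W y"
      using True pos[OF True] by (simp add: W_def ennreal_mult[symmetric])
    finally show ?thesis .
  qed
  define J where "J = (\<integral>\<^sup>+x. \<integral>\<^sup>+y. g x y * (W x * k x y) \<partial>lebesgue \<partial>lebesgue)"
  have J: "J \<le> local_seminorm \<Omega> \<phi> p R u"
    unfolding J_def local_seminorm_def
  proof (rule nn_integral_mono)
    fix x
    show "(\<integral>\<^sup>+y. g x y * (W x * k x y) \<partial>lebesgue)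
      \<le> (\<integral>\<^sup>+y\<in>\<Omega> \<inter> ball x (R * ?\<delta> x). ennreal (\<bar>u x - u y\<bar> powr p / (\<phi> (?\<delta> x) * ?\<delta> x ^ ?n)) \<partial>lebesgue)
          * indicator \<Omega> x"
    proof (cases "x \<in> \<Omega>")
      case True
      have "(\<integral>\<^sup>+y. g x y * (W x * k x y) \<partial>lebesgue)
        \<le> (\<integral>\<^sup>+y\<in>\<Omega> \<inter> ball x (R * ?\<delta> x). ennreal (\<bar>u x - u y\<bar> powr p / (\<phi> (?\<delta> x) * ?\<delta> x ^ ?n)) \<partial>lebesgue)"
      proof (rule nn_integral_mono)
        fix y
        show "g x y * (W x * k x y) \<le> ennreal (\<bar>u x - u y\<bar> powr p / (\<phi> (?\<delta> x) * ?\<delta> x ^ ?n))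
            * indicator (\<Omega> \<inter> ball x (R * ?\<delta> x)) y"
        proof (cases "(x, y) \<in> A")
          case xy: True
          then have "y \<in> \<Omega> \<inter> ball x (R * ?\<delta> x)" using A(4) by auto
          then show ?thesis using True xy pos[OF True]
            by (simp add: g_def W_def k_def v_def ennreal_mult[symmetric])
        qed (simp add: k_def)
      qed
      then show ?thesis using True by simp
    qed (simp add: W_def)
  qed
  have "I \<le> (\<integral>\<^sup>+x. (\<integral>\<^sup>+y. f x * (W x * (ennreal a * k x y)) \<partial>lebesgue)
      + f x * W x * indicator (\<Omega> - G) x \<partial>lebesgue)"
    unfolding I
  proof (rule nn_integral_mono)
    fix x
    show "f x * W x \<le> (\<integral>\<^sup>+y. f x * (W x * (ennreal a * k x y)) \<partial>lebesgue)
      + f x * W x * indicator (\<Omega> - G) x"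
    proof (cases "x \<in> G")
      case True
      have "f x * W x = f x * W x * 1" by simp
      also have "\<dots> \<le> f x * W x * (\<integral>\<^sup>+y. ennreal a * k x y \<partial>lebesgue)"
        using mass[OF True] by (rule mult_left_mono) simp
      also have "\<dots> = (\<integral>\<^sup>+y. f x * W x * (ennreal a * k x y) \<partial>lebesgue)"
        by (rule nn_integral_cmult[symmetric]) measurable
      finally show ?thesis using True by (simp add: mult.assoc)
    next
      case False
      then show ?thesis by (cases "x \<in> \<Omega>") (auto simp: W_def)
    qed
  qed
  also have "\<dots> = (\<integral>\<^sup>+x. (\<integral>\<^sup>+y. f x * (W x * (ennreal a * k x y)) \<partial>lebesgue) \<partial>lebesgue) + Y"
    unfolding Y by (rule nn_integral_add) measurable
  also have "(\<integral>\<^sup>+x. (\<integral>\<^sup>+y. f x * (W x * (ennreal a * k x y)) \<partial>lebesgue) \<partial>lebesgue)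
      \<le> (\<integral>\<^sup>+x. (\<integral>\<^sup>+y. ennreal (2 powr p) * (ennreal a * (g x y * (W x * k x y)) + f y * (W x * (ennreal a * k x y))) \<partial>lebesgue) \<partial>lebesgue)"
  proof (intro nn_integral_mono)
    fix x y
    have "f x \<le> ennreal (2 powr p) * (g x y + f y)"
      unfolding f_def g_def using abs_powr_le_add[OF p, of "v x" "v y"]
      by (simp add: ennreal_mult[symmetric] ennreal_plus[symmetric] ennreal_leI del: ennreal_plus)
    then have "f x * (W x * (ennreal a * k x y)) \<le> ennreal (2 powr p) * (g x y + f y) * (W x * (ennreal a * k x y))"
      by (rule mult_right_mono) simp
    also have "\<dots> = ennreal (2 powr p) * (ennreal a * (g x y * (W x * k x y)) + f y * (W x * (ennreal a * k x y)))"
      by (simp add: algebra_simps)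
    finally show "f x * (W x * (ennreal a * k x y))
      \<le> ennreal (2 powr p) * (ennreal a * (g x y * (W x * k x y)) + f y * (W x * (ennreal a * k x y)))" .
  qed
  also have "\<dots> = ennreal (2 powr p) * (ennreal a * J
      + (\<integral>\<^sup>+x. \<integral>\<^sup>+y. f y * (W x * (ennreal a * k x y)) \<partial>lebesgue \<partial>lebesgue))"
    unfolding J_def by (simp add: nn_integral_cmult nn_integral_add)
  also have "(\<integral>\<^sup>+x. \<integral>\<^sup>+y. f y * (W x * (ennreal a * k x y)) \<partial>lebesgue \<partial>lebesgue)
      = (\<integral>\<^sup>+y. \<integral>\<^sup>+x. f y * (W x * (ennreal a * k x y)) \<partial>lebesgue \<partial>lebesgue)"
    by (rule P.Fubini'[symmetric]) measurable
  also have "\<dots> = (\<integral>\<^sup>+y. f y * (\<integral>\<^sup>+x. W x * (ennreal a * k x y) \<partial>lebesgue) \<partial>lebesgue)"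
    by (intro nn_integral_cong nn_integral_cmult) measurable
  also have "\<dots> \<le> (\<integral>\<^sup>+y. ennreal (1 / (2 * 2 powr p)) * (f y * W y) \<partial>lebesgue)"
  proof (rule nn_integral_mono)
    fix y
    have "f y * (\<integral>\<^sup>+x. W x * (ennreal a * k x y) \<partial>lebesgue) \<le> f y * (ennreal (1 / (2 * 2 powr p)) * W y)"
      using transported by (rule mult_left_mono) simp
    then show "f y * (\<integral>\<^sup>+x. W x * (ennreal a * k x y) \<partial>lebesgue) \<le> ennreal (1 / (2 * 2 powr p)) * (f y * W y)"
      by (simp add: mult.left_commute)
  qed
  also have "\<dots> = ennreal (1 / (2 * 2 powr p)) * I"
    unfolding I by (rule nn_integral_cmult) measurable
  finally have "I \<le> ennreal (2 powr p) * (ennreal a * J + ennreal (1 / (2 * 2 powr p)) * I) + Y"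
    by (simp add: add_mono mult_left_mono)
  also have "\<dots> = (ennreal (2 powr p * a) * J + Y) + ennreal (1 / 2) * I"
    using A(2) by (simp add: distrib_left mult.assoc[symmetric] ennreal_mult[symmetric] add_ac)
  finally have "I \<le> 2 * (ennreal (2 powr p * a) * J + Y)"
    using fin by (intro ennreal_absorb_half) (auto simp: I_def)
  also have "\<dots> = ennreal (2 * (2 powr p * a)) * J + 2 * Y"
    using A(2) by (simp add: distrib_left mult.assoc[symmetric] ennreal_mult)
  also have "\<dots> \<le> ennreal (2 * (2 powr p * a)) * local_seminorm \<Omega> \<phi> p R u + 2 * Y"
    using J by (intro add_mono mult_left_mono) auto
  finally show ?thesis unfolding I_def Y_def .
qed

section \<open>Measurable majorants of weights\<close>

text \<open>A function in one of the scaling classes can fail to be measurable, and then Tonelli's theorem is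
  not available for the weight. Divided by \<open>s powr \<eta>\<close> it is monotone up to the factor \<open>H\<close>, and its
  least monotone majorant is measurable and comparable to it. Substituting \<open>s = exp x\<close> or
  \<open>s = exp (- x)\<close> reduces both classes to functions on the whole line that decrease up to this factor.\<close>

lemma measurable_majorant_of_almost_antimono:
  fixes f :: "real \<Rightarrow> real"
  assumes "0 < H" and dec: "\<And>a b. a \<le> b \<Longrightarrow> H * f b \<le> f a"
  obtains h where "h \<in> borel_measurable borel" "\<And>x. f x \<le> h x" "\<And>x. H * h x \<le> f x"
proof -
  define h where "h = (\<lambda>x. SUP b\<in>{x..}. f b)"
  have le: "f b \<le> f x / H" if "x \<le> b" for x b
    using dec[OF that] assms(1) by (simp add: field_simps)
  then have bdd: "bdd_above (f ` {x..})" for x by (intro bdd_aboveI[of _ "f x / H"]) auto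
  have "mono (\<lambda>x. - h x)"
    unfolding h_def by (intro monoI le_imp_neg_le cSUP_subset_mono bdd) auto
  then have "(\<lambda>x. - h x) \<in> borel_measurable borel" by (rule borel_measurable_mono)
  from borel_measurable_uminus[OF this] have "h \<in> borel_measurable borel" by simp
  moreover have "f x \<le> h x" for x
    unfolding h_def by (intro cSUP_upper bdd) auto
  moreover have "H * h x \<le> f x" for x
  proof -
    have "h x \<le> f x / H" unfolding h_def using le by (intro cSUP_least) auto
    then show ?thesis using assms(1) by (simp add: field_simps)
  qed
  ultimately show thesis using that by simp
qed

lemma measurable_majorant_WUSC0:
  assumes \<phi>: "\<phi> \<in> WUSC0 \<eta> (inverse H)" and H: "0 < H"
  obtains \<psi> where "\<psi> \<in> borel_measurable borel" "\<psi> \<in> WUSC0 \<eta> (inverse (H * H))"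
    "\<And>s. 0 < s \<Longrightarrow> \<phi> s \<le> \<psi> s" "\<And>s. 0 < s \<Longrightarrow> H * \<psi> s \<le> \<phi> s"
proof -
  have "H * (\<phi> (exp b) / exp b powr \<eta>) \<le> \<phi> (exp a) / exp a powr \<eta>" if "a \<le> b" for a b
    using WUSC0_D(2)[OF \<phi>, of "exp a" "exp b"] that by (simp add: powr_divide field_simps)
  then obtain h where h: "h \<in> borel_measurable borel" "\<And>x. \<phi> (exp x) / exp x powr \<eta> \<le> h x"
      "\<And>x. H * h x \<le> \<phi> (exp x) / exp x powr \<eta>"
    using measurable_majorant_of_almost_antimono[of H "\<lambda>x. \<phi> (exp x) / exp x powr \<eta>"] H by metis
  define \<psi> where "\<psi> = (\<lambda>s. s powr \<eta> * h (ln s))"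
  have le: "\<phi> s \<le> \<psi> s" if "0 < s" for s
    using h(2)[of "ln s"] that by (simp add: \<psi>_def field_simps)
  have ge: "H * \<psi> s \<le> \<phi> s" if "0 < s" for s
    using h(3)[of "ln s"] that by (simp add: \<psi>_def field_simps)
  have meas: "\<psi> \<in> borel_measurable borel"
    unfolding \<psi>_def using h(1) by measurable
  have pos: "0 < \<psi> s" if "0 < s" for s
    using le[OF that] WUSC0_D(1)[OF \<phi> that] by linarith
  have "\<psi> \<in> WUSC0 \<eta> (inverse (H * H))"
    unfolding WUSC0_def inverse_inverse_eq
  proof (intro CollectI conjI allI impI)
    fix s t :: real assume s: "0 < s" and t: "0 < t \<and> t \<le> 1"
    have "H * H * t powr \<eta> * \<psi> s = H * t powr \<eta> * (H * \<psi> s)" by simp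
    also have "\<dots> \<le> H * t powr \<eta> * \<phi> s" using ge[OF s] H by (intro mult_left_mono) auto
    also have "\<dots> \<le> \<phi> (s * t)"
      using WUSC0_D(2)[OF \<phi>, of "s * t" s] s t by (simp add: mult_left_le)
    also have "\<dots> \<le> \<psi> (s * t)" using le s t by simp
    finally show "H * H * t powr \<eta> * \<psi> s \<le> \<psi> (s * t)" .
  qed (rule pos)
  then show thesis using that meas le ge by blast
qed

lemma measurable_majorant_WLSC0:
  assumes \<phi>: "\<phi> \<in> WLSC0 \<eta> H" and H: "0 < H"
  obtains \<psi> where "\<psi> \<in> borel_measurable borel" "\<psi> \<in> WLSC0 \<eta> (H * H)"
    "\<And>s. 0 < s \<Longrightarrow> \<phi> s \<le> \<psi> s" "\<And>s. 0 < s \<Longrightarrow> H * \<psi> s \<le> \<phi> s"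
proof -
  have "H * (\<phi> (exp (- b)) / exp (- b) powr \<eta>) \<le> \<phi> (exp (- a)) / exp (- a) powr \<eta>" if "a \<le> b" for a b
    using WLSC0_D(2)[OF \<phi>, of "exp (- b)" "exp (- a)"] that by (simp add: powr_divide field_simps)
  then obtain h where h: "h \<in> borel_measurable borel" "\<And>x. \<phi> (exp (- x)) / exp (- x) powr \<eta> \<le> h x"
      "\<And>x. H * h x \<le> \<phi> (exp (- x)) / exp (- x) powr \<eta>"
    using measurable_majorant_of_almost_antimono[of H "\<lambda>x. \<phi> (exp (- x)) / exp (- x) powr \<eta>"] H by metis
  define \<psi> where "\<psi> = (\<lambda>s. s powr \<eta> * h (- ln s))"
  have le: "\<phi> s \<le> \<psi> s" if "0 < s" for s
    using h(2)[of "- ln s"] that by (simp add: \<psi>_def field_simps)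
  have ge: "H * \<psi> s \<le> \<phi> s" if "0 < s" for s
    using h(3)[of "- ln s"] that by (simp add: \<psi>_def field_simps)
  have meas: "\<psi> \<in> borel_measurable borel"
    unfolding \<psi>_def using h(1) by measurable
  have pos: "0 < \<psi> s" if "0 < s" for s
    using le[OF that] WLSC0_D(1)[OF \<phi> that] by linarith
  have "\<psi> \<in> WLSC0 \<eta> (H * H)"
    unfolding WLSC0_def
  proof (intro CollectI conjI allI impI)
    fix s t :: real assume s: "0 < s" and t: "1 \<le> t"
    have "H * H * t powr \<eta> * \<psi> s = H * t powr \<eta> * (H * \<psi> s)" by simp
    also have "\<dots> \<le> H * t powr \<eta> * \<phi> s" using ge[OF s] H by (intro mult_left_mono) auto
    also have "\<dots> \<le> \<phi> (s * t)"
      using WLSC0_D(2)[OF \<phi>, of s "s * t"] s t by simp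
    also have "\<dots> \<le> \<psi> (s * t)" using le s t by simp
    finally show "H * H * t powr \<eta> * \<psi> s \<le> \<psi> (s * t)" .
  qed (rule pos)
  then show thesis using that meas le ge by blast
qed

text \<open>The integral of a nonmeasurable nonnegative function is the supremum over the simple functions
  below it, so it is monotone, and monotonicity is all that is needed to pass from \<open>\<psi>\<close> to a
  comparable \<open>\<phi>\<close> on both sides. Only the constant factor is moved out of an integral, and there the
  integrand contains \<open>\<psi>\<close>.\<close>

lemma averaging_inequality:
  fixes \<Omega> :: "'a::euclidean_space set" and u :: "'a \<Rightarrow> real"
  assumes \<Omega>: "open \<Omega>" "\<Omega> \<noteq> UNIV" and p: "0 < p" and H: "0 < H"
    and ker: "averaging_kernel \<Omega> \<psi> G (1 / (2 * 2 powr p)) a R A"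
    and \<psi>: "\<psi> \<in> borel_measurable borel" "\<And>s. 0 < s \<Longrightarrow> \<phi> s \<le> \<psi> s" "\<And>s. 0 < s \<Longrightarrow> H * \<psi> s \<le> \<phi> s"
    and \<phi>: "\<And>s. 0 < s \<Longrightarrow> 0 < \<phi> s"
    and u: "u \<in> borel_measurable (lebesgue_on \<Omega>)"
    and G: "G \<subseteq> \<Omega>" "G \<in> sets lebesgue"
    and fin: "weighted_norm \<Omega> \<phi> p u < \<infinity>"
  shows "weighted_norm \<Omega> \<phi> p u \<le> ennreal (1 / H) * (ennreal (2 * (2 powr p * a)) * local_seminorm \<Omega> \<phi> p R u
     + 2 * (\<integral>\<^sup>+x\<in>\<Omega> - G. ennreal (\<bar>u x\<bar> powr p / \<phi> (bdist \<Omega> x)) \<partial>lebesgue))"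
proof -
  let ?\<delta> = "bdist \<Omega>"
  have pos: "0 < ?\<delta> x" if "x \<in> \<Omega>" for x using bdist_pos[OF \<Omega> that] .
  have \<psi>pos: "0 < \<psi> s" if "0 < s" for s using \<phi>[OF that] \<psi>(2)[OF that] by linarith
  have div_le: "c / \<psi> (?\<delta> x) \<le> c / \<phi> (?\<delta> x)" if "x \<in> \<Omega>" "0 \<le> c" for x c
    using \<phi>[OF pos[OF that(1)]] \<psi>pos[OF pos[OF that(1)]] \<psi>(2)[OF pos[OF that(1)]] that(2)
    by (intro divide_left_mono mult_pos_pos) auto
  have norm_le: "weighted_norm \<Omega> \<psi> p u \<le> weighted_norm \<Omega> \<phi> p u"
    unfolding weighted_norm_def
    by (intro nn_integral_mono) (auto simp: indicator_def intro!: ennreal_leI div_le)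
  have semi_le: "local_seminorm \<Omega> \<psi> p R u \<le> local_seminorm \<Omega> \<phi> p R u"
    unfolding local_seminorm_def
  proof (intro nn_integral_mono)
    fix x
    show "(\<integral>\<^sup>+y\<in>\<Omega> \<inter> ball x (R * ?\<delta> x). ennreal (\<bar>u x - u y\<bar> powr p / (\<psi> (?\<delta> x) * ?\<delta> x ^ DIM('a))) \<partial>lebesgue) * indicator \<Omega> x
      \<le> (\<integral>\<^sup>+y\<in>\<Omega> \<inter> ball x (R * ?\<delta> x). ennreal (\<bar>u x - u y\<bar> powr p / (\<phi> (?\<delta> x) * ?\<delta> x ^ DIM('a))) \<partial>lebesgue) * indicator \<Omega> x"
    proof (cases "x \<in> \<Omega>")
      case True
      have "\<bar>u x - u y\<bar> powr p / (\<psi> (?\<delta> x) * ?\<delta> x ^ DIM('a)) \<le> \<bar>u x - u y\<bar> powr p / (\<phi> (?\<delta> x) * ?\<delta> x ^ DIM('a))" for y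
        using div_le[OF True, of "\<bar>u x - u y\<bar> powr p / ?\<delta> x ^ DIM('a)"] pos[OF True]
        by (simp add: mult.commute)
      then show ?thesis
        by (intro mult_right_mono nn_integral_mono) (auto intro!: mult_right_mono ennreal_leI)
    qed simp
  qed
  have rest_le: "(\<integral>\<^sup>+x\<in>\<Omega> - G. ennreal (\<bar>u x\<bar> powr p / \<psi> (?\<delta> x)) \<partial>lebesgue)
      \<le> (\<integral>\<^sup>+x\<in>\<Omega> - G. ennreal (\<bar>u x\<bar> powr p / \<phi> (?\<delta> x)) \<partial>lebesgue)"
    by (intro nn_integral_mono) (auto simp: indicator_def intro!: ennreal_leI div_le)
  have "weighted_norm \<Omega> \<phi> p u \<le> (\<integral>\<^sup>+x. ennreal (1 / H) * (ennreal (\<bar>u x\<bar> powr p / \<psi> (?\<delta> x)) * indicator \<Omega> x) \<partial>lebesgue)"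
    unfolding weighted_norm_def
  proof (rule nn_integral_mono)
    fix x
    show "ennreal (\<bar>u x\<bar> powr p / \<phi> (?\<delta> x)) * indicator \<Omega> x
      \<le> ennreal (1 / H) * (ennreal (\<bar>u x\<bar> powr p / \<psi> (?\<delta> x)) * indicator \<Omega> x)"
    proof (cases "x \<in> \<Omega>")
      case True
      have "\<bar>u x\<bar> powr p / \<phi> (?\<delta> x) \<le> \<bar>u x\<bar> powr p / (H * \<psi> (?\<delta> x))"
        using \<phi>[OF pos[OF True]] \<psi>pos[OF pos[OF True]] \<psi>(3)[OF pos[OF True]] H
        by (intro divide_left_mono mult_pos_pos) auto
      also have "\<dots> = 1 / H * (\<bar>u x\<bar> powr p / \<psi> (?\<delta> x))" by simp
      finally have "ennreal (\<bar>u x\<bar> powr p / \<phi> (?\<delta> x)) \<le> ennreal (1 / H * (\<bar>u x\<bar> powr p / \<psi> (?\<delta> x)))"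
        by (rule ennreal_leI)
      then show ?thesis using True H \<psi>pos[OF pos[OF True]] by (simp add: ennreal_mult[symmetric])
    qed simp
  qed
  also have "\<dots> = ennreal (1 / H) * weighted_norm \<Omega> \<psi> p u"
    unfolding weighted_norm_def
  proof (rule nn_integral_cmult)
    have \<delta>b: "?\<delta> \<in> borel_measurable borel"
      by (rule borel_measurable_continuous_onI[OF continuous_bdist])
    have [measurable]: "(\<lambda>x. if x \<in> \<Omega> then u x else 0) \<in> borel_measurable lebesgue" "\<Omega> \<in> sets lebesgue"
      using \<Omega>(1) by (auto intro: borel_measurable_if_I[OF u])
    have [measurable]: "(\<lambda>x. \<psi> (?\<delta> x)) \<in> borel_measurable lebesgue"
      using measurable_compose[OF \<delta>b \<psi>(1)] by (auto intro!: measurable_completion)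
    have "(\<lambda>x. ennreal (\<bar>if x \<in> \<Omega> then u x else 0\<bar> powr p / \<psi> (?\<delta> x)) * indicator \<Omega> x) \<in> borel_measurable lebesgue"
      by measurable
    then show "(\<lambda>x. ennreal (\<bar>u x\<bar> powr p / \<psi> (?\<delta> x)) * indicator \<Omega> x) \<in> borel_measurable lebesgue"
      by (rule measurable_cong[THEN iffD1, rotated]) (simp add: indicator_def)
  qed
  also have "\<dots> \<le> ennreal (1 / H) * (ennreal (2 * (2 powr p * a)) * local_seminorm \<Omega> \<psi> p R u
     + 2 * (\<integral>\<^sup>+x\<in>\<Omega> - G. ennreal (\<bar>u x\<bar> powr p / \<psi> (?\<delta> x)) \<partial>lebesgue))"
    using averaging_inequality_measurable[OF \<Omega> p ker \<psi>(1) \<psi>pos u G] norm_le fin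
    by (intro mult_left_mono) auto
  also have "\<dots> \<le> ennreal (1 / H) * (ennreal (2 * (2 powr p * a)) * local_seminorm \<Omega> \<phi> p R u
     + 2 * (\<integral>\<^sup>+x\<in>\<Omega> - G. ennreal (\<bar>u x\<bar> powr p / \<phi> (?\<delta> x)) \<partial>lebesgue))"
    using semi_le rest_le by (intro mult_left_mono add_mono) auto
  finally show ?thesis .
qed

section \<open>Hardy inequalities\<close>

definition Hardy_inequality ::
    "'a::euclidean_space set \<Rightarrow> (real \<Rightarrow> real) \<Rightarrow> real \<Rightarrow> real \<Rightarrow> real \<Rightarrow> real \<Rightarrow> bool" where
  "Hardy_inequality \<Omega> \<phi> p \<xi> c R \<longleftrightarrow>
     (\<forall>u \<in> borel_measurable (lebesgue_on \<Omega>). weighted_norm \<Omega> \<phi> p u < \<infinity> \<longrightarrow>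
        weighted_norm \<Omega> \<phi> p u \<le> ennreal c * local_seminorm \<Omega> \<phi> p R u
          + ennreal (c * \<xi>) * (\<integral>\<^sup>+x\<in>\<Omega>. ennreal (\<bar>u x\<bar> powr p) \<partial>lebesgue))"

lemma Hardy_inequality_mono:
  assumes "Hardy_inequality \<Omega> \<phi> p \<xi> c R" "0 \<le> c" "\<xi> \<le> \<xi>'"
  shows "Hardy_inequality \<Omega> \<phi> p \<xi>' c R"
proof -
  have "ennreal (c * \<xi>) \<le> ennreal (c * \<xi>')" using assms by (intro ennreal_leI mult_left_mono)
  then show ?thesis
    using assms(1) unfolding Hardy_inequality_def
    by (meson add_left_mono mult_right_mono order_trans zero_le)
qed

text \<open>Points outside \<open>G\<close> have no average. Where they exist, \<open>\<phi>\<close> has to be bounded below on them, and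
  they are paid for by the unweighted norm, which is the reason for \<open>\<xi>\<close>.\<close>

lemma Hardy_inequality_of_kernel:
  fixes \<Omega> :: "'a::euclidean_space set"
  assumes \<Omega>: "open \<Omega>" "\<Omega> \<noteq> UNIV" and p: "0 < p" and H: "0 < H"
    and ker: "averaging_kernel \<Omega> \<psi> G (1 / (2 * 2 powr p)) a R A"
    and \<psi>: "\<psi> \<in> borel_measurable borel" "\<And>s. 0 < s \<Longrightarrow> \<phi> s \<le> \<psi> s" "\<And>s. 0 < s \<Longrightarrow> H * \<psi> s \<le> \<phi> s"
    and \<phi>: "\<And>s. 0 < s \<Longrightarrow> 0 < \<phi> s"
    and G: "G \<subseteq> \<Omega>" "G \<in> sets lebesgue"
    and m: "0 < m" "\<And>x. x \<in> \<Omega> - G \<Longrightarrow> m \<le> \<phi> (bdist \<Omega> x)"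
    and \<xi>: "\<xi> = (if G = \<Omega> then 0 else 1)"
  shows "\<exists>c>0. \<exists>R>0. Hardy_inequality \<Omega> \<phi> p \<xi> c R"
proof -
  have a: "0 < a" and R: "0 < R" using ker by (auto simp: averaging_kernel_def)
  define c where "c = max (1 / H * (2 * (2 powr p * a))) (1 / H * (2 * (1 / m)))"
  have c: "0 < c" "1 / H * (2 * (2 powr p * a)) \<le> c" "1 / H * (2 * (1 / m)) \<le> c"
    using H a by (auto simp: c_def less_max_iff_disj)
  have "Hardy_inequality \<Omega> \<phi> p \<xi> c R"
    unfolding Hardy_inequality_def
  proof (intro ballI impI)
    fix u assume u: "u \<in> borel_measurable (lebesgue_on \<Omega>)" and fin: "weighted_norm \<Omega> \<phi> p u < \<infinity>"
    define N where "N = (\<integral>\<^sup>+x\<in>\<Omega>. ennreal (\<bar>u x\<bar> powr p) \<partial>lebesgue)"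
    have rest: "(\<integral>\<^sup>+x\<in>\<Omega> - G. ennreal (\<bar>u x\<bar> powr p / \<phi> (bdist \<Omega> x)) \<partial>lebesgue) \<le> ennreal (1 / m * \<xi>) * N"
    proof (cases "G = \<Omega>")
      case True
      then show ?thesis by simp
    next
      case False
      have "(\<integral>\<^sup>+x\<in>\<Omega> - G. ennreal (\<bar>u x\<bar> powr p / \<phi> (bdist \<Omega> x)) \<partial>lebesgue)
          \<le> (\<integral>\<^sup>+x. ennreal (1 / m) * (ennreal (\<bar>u x\<bar> powr p) * indicator \<Omega> x) \<partial>lebesgue)"
      proof (rule nn_integral_mono)
        fix x
        show "ennreal (\<bar>u x\<bar> powr p / \<phi> (bdist \<Omega> x)) * indicator (\<Omega> - G) x
          \<le> ennreal (1 / m) * (ennreal (\<bar>u x\<bar> powr p) * indicator \<Omega> x)"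
        proof (cases "x \<in> \<Omega> - G")
          case True
          have "\<bar>u x\<bar> powr p / \<phi> (bdist \<Omega> x) \<le> \<bar>u x\<bar> powr p / m"
            using m(1) m(2)[OF True] by (intro divide_left_mono mult_pos_pos) auto
          then have "ennreal (\<bar>u x\<bar> powr p / \<phi> (bdist \<Omega> x)) \<le> ennreal (1 / m * \<bar>u x\<bar> powr p)"
            by (intro ennreal_leI) simp
          then show ?thesis using True m(1) by (simp add: ennreal_mult[symmetric])
        qed simp
      qed
      also have "\<dots> = ennreal (1 / m) * N"
        unfolding N_def
      proof (rule nn_integral_cmult)
        have [measurable]: "(\<lambda>x. if x \<in> \<Omega> then u x else 0) \<in> borel_measurable lebesgue" "\<Omega> \<in> sets lebesgue"
          using \<Omega>(1) by (auto intro: borel_measurable_if_I[OF u])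
        have "(\<lambda>x. ennreal (\<bar>if x \<in> \<Omega> then u x else 0\<bar> powr p) * indicator \<Omega> x) \<in> borel_measurable lebesgue"
          by measurable
        then show "(\<lambda>x. ennreal (\<bar>u x\<bar> powr p) * indicator \<Omega> x) \<in> borel_measurable lebesgue"
          by (rule measurable_cong[THEN iffD1, rotated]) (simp add: indicator_def)
      qed
      finally show ?thesis using False by (simp add: \<xi>)
    qed
    have \<xi>0: "0 \<le> \<xi>" by (simp add: \<xi>)
    have "weighted_norm \<Omega> \<phi> p u \<le> ennreal (1 / H) * (ennreal (2 * (2 powr p * a)) * local_seminorm \<Omega> \<phi> p R u
        + 2 * (\<integral>\<^sup>+x\<in>\<Omega> - G. ennreal (\<bar>u x\<bar> powr p / \<phi> (bdist \<Omega> x)) \<partial>lebesgue))"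
      by (rule averaging_inequality[OF \<Omega> p H ker \<psi> \<phi> u G fin])
    also have "\<dots> \<le> ennreal (1 / H) * (ennreal (2 * (2 powr p * a)) * local_seminorm \<Omega> \<phi> p R u
        + ennreal 2 * (ennreal (1 / m * \<xi>) * N))"
      by (intro mult_left_mono add_left_mono mult_mono rest) auto
    also have "\<dots> = ennreal (1 / H * (2 * (2 powr p * a))) * local_seminorm \<Omega> \<phi> p R u
        + ennreal (1 / H * (2 * (1 / m)) * \<xi>) * N"
      using H a m(1) \<xi>0 by (simp only: distrib_left mult.assoc[symmetric] ennreal_mult'[symmetric]
          zero_le_mult_iff zero_le_divide_iff) (simp add: ennreal_mult'[symmetric] mult.assoc)
    also have "\<dots> \<le> ennreal c * local_seminorm \<Omega> \<phi> p R u + ennreal (c * \<xi>) * N"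
      using c(2,3) \<xi>0 by (intro add_mono mult_right_mono ennreal_leI) auto
    finally show "weighted_norm \<Omega> \<phi> p u \<le> ennreal c * local_seminorm \<Omega> \<phi> p R u + ennreal (c * \<xi>) * N" .
  qed
  then show ?thesis using c R by blast
qed

text \<open>If \<open>\<Omega>\<close> is unbounded, plumpness is available at every scale and every point can be averaged over
  deeper ones. If \<open>\<Omega>\<close> is bounded, points whose depth is comparable to the diameter
  may have nothing sufficiently deeper; at these depths, a compact range in the positive half-line,
  \<open>\<phi>\<close> is bounded below.\<close>

lemma Hardy_inequality_thin_boundary:
  fixes \<Omega> :: "'a::euclidean_space set"
  assumes \<Omega>: "open \<Omega>" "\<Omega> \<noteq> {}" "\<Omega> \<noteq> UNIV" and p: "0 < p" and plump: "plump \<kappa> \<Omega>"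
    and H: "0 < H" and \<phi>: "\<phi> \<in> WUSC0 \<eta> (inverse H)"
    and dim: "upper_Assouad_dim (frontier \<Omega>) < ereal (real DIM('a) - \<eta>)"
  shows "\<exists>c>0. \<exists>R>0. Hardy_inequality \<Omega> \<phi> p (if bounded \<Omega> then 1 else 0) c R"
proof -
  let ?\<delta> = "bdist \<Omega>"
  obtain \<psi> where \<psi>: "\<psi> \<in> borel_measurable borel" "\<psi> \<in> WUSC0 \<eta> (inverse (H * H))"
    "\<And>s. 0 < s \<Longrightarrow> \<phi> s \<le> \<psi> s" "\<And>s. 0 < s \<Longrightarrow> H * \<psi> s \<le> \<phi> s"
    using measurable_majorant_WUSC0[OF \<phi> H] by blast
  have "0 < H * H" using H by simp
  moreover have "0 < 1 / (2 * 2 powr p)" by simp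
  ultimately obtain L a R A where L: "0 < L"
    and ker: "averaging_kernel \<Omega> \<psi> {x \<in> \<Omega>. ennreal (L * ?\<delta> x) < ediam \<Omega>} (1 / (2 * 2 powr p)) a R A"
    using kernel_away_from_boundary[OF \<Omega> plump _ \<psi>(2) dim] by metis
  define G where "G = {x \<in> \<Omega>. ennreal (L * ?\<delta> x) < ediam \<Omega>}"
  have Gsub: "G \<subseteq> \<Omega>" by (auto simp: G_def)
  have Gsets: "G \<in> sets lebesgue"
  proof -
    have [measurable]: "?\<delta> \<in> borel_measurable borel"
      by (rule borel_measurable_continuous_onI[OF continuous_bdist])
    have [measurable]: "\<Omega> \<in> sets borel" using \<Omega>(1) by simp
    have "{x \<in> space borel. x \<in> \<Omega> \<and> ennreal (L * ?\<delta> x) < ediam \<Omega>} \<in> sets borel" by measurable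
    then have "G \<in> sets borel" by (simp add: G_def)
    then show ?thesis by simp
  qed
  have pos: "0 < \<phi> s" if "0 < s" for s by (rule WUSC0_D(1)[OF \<phi> that])
  show ?thesis
  proof (cases "bounded \<Omega>")
    case False
    then have "G = \<Omega>" using less_ediam_of_unbounded[OF False] by (auto simp: G_def)
    then show ?thesis
      using Hardy_inequality_of_kernel[OF \<Omega>(1,3) p H ker[folded G_def] \<psi>(1,3,4) pos Gsub Gsets, of 1] False by simp
  next
    case True
    obtain w where w: "w \<in> frontier \<Omega>" using frontier_closed_nonempty(2)[OF \<Omega>(2,3)] by blast
    obtain S0 where S0: "\<And>x. x \<in> \<Omega> \<Longrightarrow> dist w x \<le> S0"
      using True bounded_any_center[of \<Omega> w] by blast
    define S where "S = max S0 1"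
    have S: "0 < S" "\<And>x. x \<in> \<Omega> \<Longrightarrow> ?\<delta> x \<le> S"
    proof -
      show "0 < S" by (simp add: S_def)
      fix x assume "x \<in> \<Omega>"
      then show "?\<delta> x \<le> S" using S0[of x] bdist_le[OF w, of x] by (simp add: S_def dist_commute)
    qed
    obtain x0 where x0: "x0 \<in> \<Omega>" using \<Omega>(2) by blast
    define d0 where "d0 = ?\<delta> x0 / 2"
    have d0: "0 < d0" using bdist_pos[OF \<Omega>(1,3) x0] by (simp add: d0_def)
    have "ennreal d0 < ediam \<Omega>"
      using less_ediam_of_less_bdist[OF x0, of d0] d0 by (simp add: d0_def)
    then have deep: "d0 < L * ?\<delta> x" if "x \<in> \<Omega> - G" for x
    proof -
      have "ediam \<Omega> \<le> ennreal (L * ?\<delta> x)" using that by (auto simp: G_def)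
      with \<open>ennreal d0 < ediam \<Omega>\<close> have "ennreal d0 < ennreal (L * ?\<delta> x)" by (rule less_le_trans)
      then show ?thesis using d0 by (simp add: ennreal_less_iff)
    qed
    define C where "C = max 1 (S * L / d0)"
    define m where "m = H * C powr (- \<bar>\<eta>\<bar>) * \<phi> S"
    have C: "1 \<le> C" by (simp add: C_def)
    have m: "0 < m" using H C pos[OF S(1)] by (simp add: m_def)
    have "m \<le> \<phi> (?\<delta> x)" if x: "x \<in> \<Omega> - G" for x
    proof -
      have dx: "0 < ?\<delta> x" using bdist_pos[OF \<Omega>(1,3)] x by blast
      have "C powr (- \<bar>\<eta>\<bar>) \<le> (?\<delta> x / S) powr \<eta>"
      proof (rule powr_ge_of_ratio_bounds[OF C])
        have "S * L / d0 \<le> C" by (simp add: C_def)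
        then have "S * L * ?\<delta> x \<le> C * d0 * ?\<delta> x" using d0 dx by (intro mult_right_mono) (simp_all add: field_simps)
        moreover have "S * d0 < S * (L * ?\<delta> x)" using deep[OF x] S(1) by simp
        ultimately have "S * d0 < (C * ?\<delta> x) * d0" by (simp add: algebra_simps)
        then have "S < C * ?\<delta> x" using d0 by simp
        then show "1 / C \<le> ?\<delta> x / S" using S(1) C by (simp add: field_simps)
        have "?\<delta> x / S \<le> 1" using S x by simp
        then show "?\<delta> x / S \<le> C" using C by linarith
      qed
      then have "m \<le> H * (?\<delta> x / S) powr \<eta> * \<phi> S"
        unfolding m_def using H pos[OF S(1)] by (intro mult_right_mono mult_left_mono) auto
      also have "\<dots> \<le> \<phi> (?\<delta> x)" using WUSC0_D(2)[OF \<phi> dx] S x by blast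
      finally show ?thesis .
    qed
    then have "\<exists>c>0. \<exists>R>0. Hardy_inequality \<Omega> \<phi> p (if G = \<Omega> then 0 else 1) c R"
      using Hardy_inequality_of_kernel[OF \<Omega>(1,3) p H ker[folded G_def] \<psi>(1,3,4) pos Gsub Gsets m _ refl] by blast
    then show ?thesis
      using Hardy_inequality_mono[of \<Omega> \<phi> p "if G = \<Omega> then 0 else 1" _ _ 1] True
      by (smt (verit) less_imp_le)
  qed
qed

text \<open>Averaging towards the boundary only uses scales up to \<open>\<delta>(x)\<close>, all of which are available for
  bounded \<open>\<Omega>\<close> as well, so that no error term appears.\<close>

lemma Hardy_inequality_fat_boundary:
  fixes \<Omega> :: "'a::euclidean_space set"
  assumes \<Omega>: "open \<Omega>" "\<Omega> \<noteq> {}" "\<Omega> \<noteq> UNIV" and p: "0 < p" and plump: "plump \<kappa> \<Omega>"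
    and H: "0 < H" and \<phi>: "\<phi> \<in> WLSC0 \<eta> H"
    and dim: "ereal (real DIM('a) - \<eta>) < lower_Assouad_dim (frontier \<Omega>)"
    and bdd: "bounded \<Omega> \<or> \<not> bounded (frontier \<Omega>)"
  shows "\<exists>c>0. \<exists>R>0. Hardy_inequality \<Omega> \<phi> p 0 c R"
proof -
  obtain \<psi> where \<psi>: "\<psi> \<in> borel_measurable borel" "\<psi> \<in> WLSC0 \<eta> (H * H)"
    "\<And>s. 0 < s \<Longrightarrow> \<phi> s \<le> \<psi> s" "\<And>s. 0 < s \<Longrightarrow> H * \<psi> s \<le> \<phi> s"
    using measurable_majorant_WLSC0[OF \<phi> H] by blast
  have "0 < H * H" using H by simp
  moreover have "0 < 1 / (2 * 2 powr p)" by simp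
  ultimately obtain a R A where ker: "averaging_kernel \<Omega> \<psi> \<Omega> (1 / (2 * 2 powr p)) a R A"
    using kernel_towards_boundary[OF \<Omega> plump _ \<psi>(2) dim bdd] by metis
  have "\<Omega> \<in> sets lebesgue" using \<Omega>(1) by simp
  then show ?thesis
    using Hardy_inequality_of_kernel[OF \<Omega>(1,3) p H ker \<psi>(1,3,4) WLSC0_D(1)[OF \<phi>] order_refl, of 1] by simp
qed

text \<open>The constants have to be chosen before \<open>\<kappa>\<close>, \<open>H\<close>, \<open>\<eta>\<close> and \<open>\<xi>\<close>. The inequality itself depends on
  these parameters only through \<open>\<xi>\<close>, and the one with \<open>\<xi> = 0\<close> implies the one with \<open>\<xi> = 1\<close> for the same
  constants. So the constants of any parameters with \<open>\<xi> = 0\<close> serve for all, and if there are no such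
  parameters, those of any parameters with \<open>\<xi> = 1\<close> do.\<close>

theorem theorem5:
  fixes \<Omega> :: "(real ^ 'n) set" and \<phi> :: "real \<Rightarrow> real" and p :: real
  assumes "0 < p"
    and "open \<Omega>" and "\<Omega> \<noteq> {}" and "\<Omega> \<noteq> UNIV"
    and "\<forall>t>0. 0 < \<phi> t"
  shows "\<exists>c>0. \<exists>R>0. \<forall>\<kappa> H \<eta> \<xi> :: real.
    plump \<kappa> \<Omega> \<longrightarrow> 0 < H \<and> H \<le> 1 \<longrightarrow>
    (ereal \<eta> + upper_Assouad_dim (frontier \<Omega>) - ereal (real CARD('n)) < 0 \<and>
       \<not> bounded \<Omega> \<and> \<phi> \<in> WUSC0 \<eta> (inverse H) \<and> \<xi> = 0) \<or>
    (ereal \<eta> + upper_Assouad_dim (frontier \<Omega>) - ereal (real CARD('n)) < 0 \<and>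
       bounded \<Omega> \<and> \<phi> \<in> WUSC0 \<eta> (inverse H) \<and> \<xi> = 1) \<or>
    (ereal \<eta> + lower_Assouad_dim (frontier \<Omega>) - ereal (real CARD('n)) > 0 \<and>
       (bounded \<Omega> \<or> \<not> bounded (frontier \<Omega>)) \<and> \<phi> \<in> WLSC0 \<eta> H \<and> \<xi> = 0) \<longrightarrow>
    (\<forall>u \<in> borel_measurable (lebesgue_on \<Omega>).
       (\<integral>\<^sup>+x\<in>\<Omega>. ennreal (\<bar>u x\<bar> powr p / \<phi> (bdist \<Omega> x)) \<partial>lebesgue) < \<infinity> \<longrightarrow>
       (\<integral>\<^sup>+x\<in>\<Omega>. ennreal (\<bar>u x\<bar> powr p / \<phi> (bdist \<Omega> x)) \<partial>lebesgue)
         \<le> ennreal c *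
             (\<integral>\<^sup>+x\<in>\<Omega>. (\<integral>\<^sup>+y\<in>\<Omega> \<inter> ball x (R * bdist \<Omega> x).
                ennreal (\<bar>u x - u y\<bar> powr p / (\<phi> (bdist \<Omega> x) * bdist \<Omega> x ^ CARD('n)))
                \<partial>lebesgue) \<partial>lebesgue)
           + ennreal (c * \<xi>) * (\<integral>\<^sup>+x\<in>\<Omega>. ennreal (\<bar>u x\<bar> powr p) \<partial>lebesgue))"
proof -
  define admissible where "admissible = (\<lambda>\<kappa> H \<eta> \<xi> :: real.
    plump \<kappa> \<Omega> \<and> (0 < H \<and> H \<le> 1) \<and>
    ((ereal \<eta> + upper_Assouad_dim (frontier \<Omega>) - ereal (real CARD('n)) < 0 \<and>
       \<not> bounded \<Omega> \<and> \<phi> \<in> WUSC0 \<eta> (inverse H) \<and> \<xi> = 0) \<or>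
    (ereal \<eta> + upper_Assouad_dim (frontier \<Omega>) - ereal (real CARD('n)) < 0 \<and>
       bounded \<Omega> \<and> \<phi> \<in> WUSC0 \<eta> (inverse H) \<and> \<xi> = 1) \<or>
    (ereal \<eta> + lower_Assouad_dim (frontier \<Omega>) - ereal (real CARD('n)) > 0 \<and>
       (bounded \<Omega> \<or> \<not> bounded (frontier \<Omega>)) \<and> \<phi> \<in> WLSC0 \<eta> H \<and> \<xi> = 0)))"
  have upper: "U < ereal (real CARD('n) - \<eta>)" if "ereal \<eta> + U - ereal (real CARD('n)) < 0" for U \<eta>
    using that by (cases U) auto
  have lower: "ereal (real CARD('n) - \<eta>) < U" if "ereal \<eta> + U - ereal (real CARD('n)) > 0" for U \<eta>
    using that by (cases U) auto
  have each: "\<exists>c>0. \<exists>R>0. Hardy_inequality \<Omega> \<phi> p \<xi> c R" if adm: "admissible \<kappa> H \<eta> \<xi>" for \<kappa> H \<eta> \<xi>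
  proof -
    have plump: "plump \<kappa> \<Omega>" and H: "0 < H" using adm by (auto simp: admissible_def)
    consider (T) "upper_Assouad_dim (frontier \<Omega>) < ereal (real CARD('n) - \<eta>)" "\<phi> \<in> WUSC0 \<eta> (inverse H)"
        "\<xi> = (if bounded \<Omega> then 1 else 0)"
      | (F) "ereal (real CARD('n) - \<eta>) < lower_Assouad_dim (frontier \<Omega>)" "\<phi> \<in> WLSC0 \<eta> H"
        "bounded \<Omega> \<or> \<not> bounded (frontier \<Omega>)" "\<xi> = 0"
      using adm upper lower unfolding admissible_def by auto
    then show ?thesis
    proof cases
      case T
      then show ?thesis
        using Hardy_inequality_thin_boundary[OF assms(2-4,1) plump H, of \<phi> \<eta>] by simp
    next
      case F
      then show ?thesis
        using Hardy_inequality_fat_boundary[OF assms(2-4,1) plump H, of \<phi> \<eta>] by simp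
    qed
  qed
  have zero_or_one: "\<xi> = 0 \<or> \<xi> = 1" if "admissible \<kappa> H \<eta> \<xi>" for \<kappa> H \<eta> \<xi>
    using that by (auto simp: admissible_def)
  have "\<exists>c>0. \<exists>R>0. \<forall>\<kappa> H \<eta> \<xi>. admissible \<kappa> H \<eta> \<xi> \<longrightarrow> Hardy_inequality \<Omega> \<phi> p \<xi> c R"
  proof (cases "\<exists>\<kappa> H \<eta>. admissible \<kappa> H \<eta> 0")
    case True
    then obtain c R where cR: "0 < c" "0 < R" "Hardy_inequality \<Omega> \<phi> p 0 c R" using each by blast
    have "Hardy_inequality \<Omega> \<phi> p \<xi> c R" if "admissible \<kappa> H \<eta> \<xi>" for \<kappa> H \<eta> \<xi>
      using zero_or_one[OF that] cR by (intro Hardy_inequality_mono[OF cR(3)]) auto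
    then show ?thesis using cR by blast
  next
    case no_zero: False
    show ?thesis
    proof (cases "\<exists>\<kappa> H \<eta>. admissible \<kappa> H \<eta> 1")
      case True
      then obtain c R where cR: "0 < c" "0 < R" "Hardy_inequality \<Omega> \<phi> p 1 c R" using each by blast
      have "Hardy_inequality \<Omega> \<phi> p \<xi> c R" if "admissible \<kappa> H \<eta> \<xi>" for \<kappa> H \<eta> \<xi>
        using zero_or_one[OF that] no_zero that cR(3) by blast
      then show ?thesis using cR by blast
    next
      case False
      then have "\<not> admissible \<kappa> H \<eta> \<xi>" for \<kappa> H \<eta> \<xi> using no_zero zero_or_one by blast
      then show ?thesis using zero_less_one by blast
    qed
  qed
  then obtain c R where cR: "0 < c" "0 < R" 
    "\<And>\<kappa> H \<eta> \<xi>. admissible \<kappa> H \<eta> \<xi> \<Longrightarrow> Hardy_inequality \<Omega> \<phi> p \<xi> c R" by blast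
  show ?thesis
  proof (rule exI[of _ c], rule conjI[OF cR(1)], rule exI[of _ R], rule conjI[OF cR(2)],
      intro allI impI ballI, rule cR(3)[unfolded Hardy_inequality_def weighted_norm_def
        local_seminorm_def DIM_cart DIM_real mult_1_right, rule_format])
  qed (unfold admissible_def, (rule conjI, assumption, rule conjI, assumption, assumption), assumption+)
qed

end
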